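(* For any $n\geq 0$, the functor $\mathcal{C}^n_{(-)}:\mathbf{dTop}\to\mathbf{Cat}$ is strongly time-reversal, i.e. there exists a natural isomorphism $\mathcal{C}^n_{(-)^\sharp}\Rightarrow(\mathcal{C}^n_{(-)})^{o}$ of functors $\mathbf{dTop}\to\mathbf{Cat}$.
   Context: Dispaces. A dispace is a pair $\mathcal{X}=(X,dX)$ with $X$ a topological space and $dX$ a set of continuous paths $[0,1]\to X$ (dipaths) containing all constant paths, closed under monotonic reparametrization (precomposition with non-decreasing continuous maps $[0,1]\to[0,1]$) and under concatenation $\star$. A morphism $(X,dX)\to(Y,dY)$ is a continuous map $X\to Y$ sending dipaths to dipaths. $\mathbf{dTop}$ is the category of dispaces. Time reversal. For a dipath $f$ let $f^\sharp(t)=f(1-t)$. The opposite dispace is $\mathcal{X}^\sharp=(X,dX^\sharp)$ with $dX^\sharp=\{f^\sharp : f\in dX\}$. This defines a functor $(-)^\sharp:\mathbf{dTop}\to\mathbf{dTop}$ leaving the underlying continuous maps unchanged. $(-)^o:\mathbf{Cat}\to\mathbf{Cat}$ is the opposite-category functor on small categories. Traces. For $x,y\in X$, the trace space $\overrightarrow{\mathfrak{T}}(\mathcal{X})(x,y)$ is the space of dipaths from $x$ to $y$ (compact-open topology) modulo the equivalence relation generated by $f\sim f\circ\varphi$, $\varphi:[0,1]\to[0,1]$ a non-decreasing continuous surjection, with the quotient topology. Elements are traces; concatenation $\star$ descends to traces. The trace category $\overrightarrow{\mathbf{P}}(\mathcal{X})$ has objects the points of $X$, morphisms the traces, composition the concatenation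 (written in diagrammatic order). Natural homotopy. For a trace $f:x\to y$: $\overrightarrow{P}_0(\mathcal{X})_f=\{f\}$; $\overrightarrow{P}_1(\mathcal{X})_f=\pi_0(\overrightarrow{\mathfrak{T}}(\mathcal{X})(x,y))$ pointed at $[f]$; and $\overrightarrow{P}_n(\mathcal{X})_f=\pi_{n-1}(\overrightarrow{\mathfrak{T}}(\mathcal{X})(x,y),f)$ for $n\geq 2$. The functor $\mathcal{C}^n_{-}$. The category $\mathcal{C}^n_{\mathcal{X}}$ has objects the points of $X$, and hom-sets $\mathcal{C}^n_{\mathcal{X}}(x,y)=\coprod_{f\in\overrightarrow{\mathbf{P}}(\mathcal{X})(x,y)}\overrightarrow{P}_n(\mathcal{X})_f$, whose elements are written $(\sigma,f)$ with $\sigma\in\overrightarrow{P}_n(\mathcal{X})_f$. For $n\leq 1$ the composite of $([f'],f):x\to y$ and $([g'],g):y\to z$ is $([f'\star g'],f\star g)$. For $n\geq 2$ the composite of $(\sigma,f):x\to y$ and $(\tau,g):y\to z$ is $(\sigma\star\tau,f\star g)$, where $\sigma\star\tau$ is the homotopy class of $t\mapsto\sigma(t)\star\tau(t)$ in $\overrightarrow{\mathfrak{T}}(\mathcal{X})(x,z)$. A morphism $\varphi:\mathcal{X}\to\mathcal{Y}$ induces continuous maps $\varphi_{x,y}:\overrightarrow{\mathfrak{T}}(\mathcal{X})(x,y)\to\overrightarrow{\mathfrak{T}}(\mathcal{Y})(\varphi(x),\varphi(y))$, and the functor $\mathcal{C}^n_\varphi$ is $x\mapsto\varphi(x)$ on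 objects and $(\sigma,f)\mapsto(\pi_{n-1}(\varphi_{x,y})(\sigma),\varphi_{x,y}(f))$ on morphisms (for $n=0$ the first component is the unique element of the singleton). *)

theory Defs
  imports "HOL-Analysis.Analysis"
begin

section \<open>Categories, functors, natural isomorphisms\<close>

text \<open>Composition is written in diagrammatic order:
  \<open>cmp C x y z f g\<close> is the composite of \<open>f : x \<rightarrow> y\<close> followed by \<open>g : y \<rightarrow> z\<close>.
  Hom-sets of different pairs of objects need not be disjoint, so the operations on morphisms
  carry the objects as arguments.\<close>

record ('o, 'm) cat =
  obj :: "'o set"
  hom :: "'o \<Rightarrow> 'o \<Rightarrow> 'm set"
  ident :: "'o \<Rightarrow> 'm"
  cmp :: "'o \<Rightarrow> 'o \<Rightarrow> 'o \<Rightarrow> 'm \<Rightarrow> 'm \<Rightarrow> 'm"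

definition is_category :: "('o, 'm) cat \<Rightarrow> bool" where
  "is_category C \<longleftrightarrow>
    (\<forall>x y f. f \<in> hom C x y \<longrightarrow> x \<in> obj C \<and> y \<in> obj C) \<and>
    (\<forall>x \<in> obj C. ident C x \<in> hom C x x) \<and>
    (\<forall>x y z f g. f \<in> hom C x y \<longrightarrow> g \<in> hom C y z \<longrightarrow> cmp C x y z f g \<in> hom C x z) \<and>
    (\<forall>x y f. f \<in> hom C x y \<longrightarrow> cmp C x x y (ident C x) f = f \<and> cmp C x y y f (ident C y) = f) \<and>
    (\<forall>w x y z f g h. f \<in> hom C w x \<longrightarrow> g \<in> hom C x y \<longrightarrow> h \<in> hom C y z \<longrightarrow>
       cmp C w y z (cmp C w x y f g) h = cmp C w x z f (cmp C x y z g h))"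

record ('o, 'm, 'o2, 'm2) funct =
  omap :: "'o \<Rightarrow> 'o2"
  mmap :: "'o \<Rightarrow> 'o \<Rightarrow> 'm \<Rightarrow> 'm2"

definition is_functor :: "('o, 'm) cat \<Rightarrow> ('o2, 'm2) cat \<Rightarrow> ('o, 'm, 'o2, 'm2) funct \<Rightarrow> bool" where
  "is_functor C D F \<longleftrightarrow>
    is_category C \<and> is_category D \<and>
    (\<forall>x \<in> obj C. omap F x \<in> obj D) \<and>
    (\<forall>x y f. f \<in> hom C x y \<longrightarrow> mmap F x y f \<in> hom D (omap F x) (omap F y)) \<and>
    (\<forall>x \<in> obj C. mmap F x x (ident C x) = ident D (omap F x)) \<and>
    (\<forall>x y z f g. f \<in> hom C x y \<longrightarrow> g \<in> hom C y z \<longrightarrow>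
       mmap F x z (cmp C x y z f g) =
       cmp D (omap F x) (omap F y) (omap F z) (mmap F x y f) (mmap F y z g))"

definition funct_comp ::
  "('o2, 'm2, 'o3, 'm3) funct \<Rightarrow> ('o, 'm, 'o2, 'm2) funct \<Rightarrow> ('o, 'm, 'o3, 'm3) funct" where
  "funct_comp G F =
    \<lparr>omap = (\<lambda>x. omap G (omap F x)),
     mmap = (\<lambda>x y f. mmap G (omap F x) (omap F y) (mmap F x y f))\<rparr>"

definition is_iso :: "('o, 'm) cat \<Rightarrow> 'o \<Rightarrow> 'o \<Rightarrow> 'm \<Rightarrow> bool" where
  "is_iso C x y f \<longleftrightarrow>
    f \<in> hom C x y \<and>
    (\<exists>g \<in> hom C y x. cmp C x y x f g = ident C x \<and> cmp C y x y g f = ident C y)"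

definition natural_transformation ::
  "('o, 'm) cat \<Rightarrow> ('o2, 'm2) cat \<Rightarrow> ('o, 'm, 'o2, 'm2) funct \<Rightarrow> ('o, 'm, 'o2, 'm2) funct
    \<Rightarrow> ('o \<Rightarrow> 'm2) \<Rightarrow> bool" where
  "natural_transformation C D F G \<eta> \<longleftrightarrow>
    is_functor C D F \<and> is_functor C D G \<and>
    (\<forall>x \<in> obj C. \<eta> x \<in> hom D (omap F x) (omap G x)) \<and>
    (\<forall>x y f. f \<in> hom C x y \<longrightarrow>
       cmp D (omap F x) (omap F y) (omap G y) (mmap F x y f) (\<eta> y) =
       cmp D (omap F x) (omap G x) (omap G y) (\<eta> x) (mmap G x y f))"

definition natural_isomorphism ::
  "('o, 'm) cat \<Rightarrow> ('o2, 'm2) cat \<Rightarrow> ('o, 'm, 'o2, 'm2) funct \<Rightarrow> ('o, 'm, 'o2, 'm2) funct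
    \<Rightarrow> ('o \<Rightarrow> 'm2) \<Rightarrow> bool" where
  "natural_isomorphism C D F G \<eta> \<longleftrightarrow>
    natural_transformation C D F G \<eta> \<and>
    (\<forall>x \<in> obj C. is_iso D (omap F x) (omap G x) (\<eta> x))"


section \<open>The category of small categories\<close>

text \<open>The objects of \<open>Cat\<close> are the categories whose objects and morphisms are drawn from two
  fixed types.  A morphism of \<open>Cat\<close> is a functor that is undefined outside its source,
  so that equality of morphisms is equality of functors.\<close>

definition funct_extensional :: "('o, 'm) cat \<Rightarrow> ('o, 'm, 'o2, 'm2) funct \<Rightarrow> bool" where
  "funct_extensional C F \<longleftrightarrow>
    omap F \<in> extensional (obj C) \<and> (\<forall>x y. mmap F x y \<in> extensional (hom C x y))"

definition Cat :: "(('o, 'm) cat, ('o, 'm, 'o, 'm) funct) cat" where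
  "Cat =
    \<lparr>obj = {C. is_category C},
     hom = (\<lambda>C D. {F. is_functor C D F \<and> funct_extensional C F}),
     ident = (\<lambda>C. \<lparr>omap = (\<lambda>x \<in> obj C. x), mmap = (\<lambda>x y. \<lambda>f \<in> hom C x y. f)\<rparr>),
     cmp = (\<lambda>C D E F G.
       \<lparr>omap = compose (obj C) (omap G) (omap F),
        mmap = (\<lambda>x y. compose (hom C x y) (mmap G (omap F x) (omap F y)) (mmap F x y))\<rparr>)\<rparr>"

definition op_cat :: "('o, 'm) cat \<Rightarrow> ('o, 'm) cat" where
  "op_cat C =
    \<lparr>obj = obj C, hom = (\<lambda>x y. hom C y x), ident = ident C,
     cmp = (\<lambda>x y z f g. cmp C z y x g f)\<rparr>"

definition op_functor ::
  "(('o, 'm) cat, ('o, 'm, 'o, 'm) funct, ('o, 'm) cat, ('o, 'm, 'o, 'm) funct) funct" where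
  "op_functor =
    \<lparr>omap = op_cat, mmap = (\<lambda>C D F. \<lparr>omap = omap F, mmap = (\<lambda>x y. mmap F y x)\<rparr>)\<rparr>"


section \<open>Dispaces\<close>

text \<open>Paths are functions on the unit interval, represented as functions of type
  \<open>real \<Rightarrow> 'a\<close> that are undefined outside of it.\<close>

record 'a dispace =
  dtop :: "'a topology"
  dpaths :: "(real \<Rightarrow> 'a) set"

definition const_path :: "'a \<Rightarrow> real \<Rightarrow> 'a" where
  "const_path x = (\<lambda>t \<in> {0..1}. x)"

definition path_concat :: "(real \<Rightarrow> 'a) \<Rightarrow> (real \<Rightarrow> 'a) \<Rightarrow> real \<Rightarrow> 'a" where
  "path_concat f g = (\<lambda>t \<in> {0..1}. if t \<le> 1/2 then f (2 * t) else g (2 * t - 1))"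

definition path_reverse :: "(real \<Rightarrow> 'a) \<Rightarrow> real \<Rightarrow> 'a" where
  "path_reverse f = (\<lambda>t \<in> {0..1}. f (1 - t))"

definition monotone_reparam :: "(real \<Rightarrow> real) \<Rightarrow> bool" where
  "monotone_reparam \<phi> \<longleftrightarrow>
    continuous_on {0..1} \<phi> \<and> \<phi> \<in> {0..1} \<rightarrow> {0..1} \<and> mono_on {0..1} \<phi>"

definition is_dispace :: "'a dispace \<Rightarrow> bool" where
  "is_dispace X \<longleftrightarrow>
    (\<forall>f \<in> dpaths X. pathin (dtop X) f \<and> f \<in> extensional {0..1}) \<and>
    (\<forall>x \<in> topspace (dtop X). const_path x \<in> dpaths X) \<and>
    (\<forall>f \<in> dpaths X. \<forall>\<phi>. monotone_reparam \<phi> \<longrightarrow> compose {0..1} f \<phi> \<in> dpaths X) \<and>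
    (\<forall>f \<in> dpaths X. \<forall>g \<in> dpaths X. f 1 = g 0 \<longrightarrow> path_concat f g \<in> dpaths X)"

definition dmaps :: "'a dispace \<Rightarrow> 'a dispace \<Rightarrow> ('a \<Rightarrow> 'a) set" where
  "dmaps X Y =
    {\<phi> \<in> extensional (topspace (dtop X)).
       continuous_map (dtop X) (dtop Y) \<phi> \<and> (\<forall>f \<in> dpaths X. compose {0..1} \<phi> f \<in> dpaths Y)}"

text \<open>The dispaces whose points are drawn from a fixed but arbitrary type.\<close>

definition dTop :: "('a dispace, 'a \<Rightarrow> 'a) cat" where
  "dTop =
    \<lparr>obj = {X. is_dispace X},
     hom = (\<lambda>X Y. if is_dispace X \<and> is_dispace Y then dmaps X Y else {}),
     ident = (\<lambda>X. \<lambda>x \<in> topspace (dtop X). x),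
     cmp = (\<lambda>X Y Z \<phi> \<psi>. compose (topspace (dtop X)) \<psi> \<phi>)\<rparr>"

definition opp_dispace :: "'a dispace \<Rightarrow> 'a dispace" where
  "opp_dispace X = \<lparr>dtop = dtop X, dpaths = path_reverse ` dpaths X\<rparr>"

definition reversal_functor :: "('a dispace, 'a \<Rightarrow> 'a, 'a dispace, 'a \<Rightarrow> 'a) funct" where
  "reversal_functor = \<lparr>omap = opp_dispace, mmap = (\<lambda>X Y \<phi>. \<phi>)\<rparr>"


section \<open>Trace spaces\<close>

definition compact_open_topology :: "'a topology \<Rightarrow> 'b topology \<Rightarrow> ('a \<Rightarrow> 'b) topology" where
  "compact_open_topology A B = topology_generated_by
    {{f \<in> extensional (topspace A). continuous_map A B f \<and> f ` K \<subseteq> U} | K U.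
      compactin A K \<and> openin B U}"

definition quotient_topology :: "'a topology \<Rightarrow> ('a \<Rightarrow> 'b) \<Rightarrow> 'b topology" where
  "quotient_topology X q =
    topology (\<lambda>U. U \<subseteq> q ` topspace X \<and> openin X {x \<in> topspace X. q x \<in> U})"

lemma openin_quotient_topology:
  "openin (quotient_topology X q) U \<longleftrightarrow>
    U \<subseteq> q ` topspace X \<and> openin X {x \<in> topspace X. q x \<in> U}"
proof -
  have "istopology (\<lambda>U. U \<subseteq> q ` topspace X \<and> openin X {x \<in> topspace X. q x \<in> U})"
    unfolding istopology_def
  proof (intro conjI allI impI)
    fix S T
    assume S: "S \<subseteq> q ` topspace X \<and> openin X {x \<in> topspace X. q x \<in> S}"
      and T: "T \<subseteq> q ` topspace X \<and> openin X {x \<in> topspace X. q x \<in> T}"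
    show "S \<inter> T \<subseteq> q ` topspace X" using S by blast
    have "openin X ({x \<in> topspace X. q x \<in> S} \<inter> {x \<in> topspace X. q x \<in> T})"
      using S T by (intro openin_Int) auto
    moreover have "{x \<in> topspace X. q x \<in> S} \<inter> {x \<in> topspace X. q x \<in> T} =
        {x \<in> topspace X. q x \<in> S \<inter> T}" by blast
    ultimately show "openin X {x \<in> topspace X. q x \<in> S \<inter> T}" by (simp only:)
  next
    fix \<K>
    assume K: "\<forall>K \<in> \<K>. K \<subseteq> q ` topspace X \<and> openin X {x \<in> topspace X. q x \<in> K}"
    show "\<Union>\<K> \<subseteq> q ` topspace X" using K by blast
    have "openin X (\<Union>K \<in> \<K>. {x \<in> topspace X. q x \<in> K})"
      using K by (intro openin_Union) auto
    moreover have "(\<Union>K \<in> \<K>. {x \<in> topspace X. q x \<in> K}) =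
        {x \<in> topspace X. q x \<in> \<Union>\<K>}" by blast
    ultimately show "openin X {x \<in> topspace X. q x \<in> \<Union>\<K>}" by (simp only:)
  qed
  then show ?thesis by (simp add: quotient_topology_def)
qed

definition dipaths :: "'a dispace \<Rightarrow> 'a \<Rightarrow> 'a \<Rightarrow> (real \<Rightarrow> 'a) set" where
  "dipaths X x y = {f \<in> dpaths X. f 0 = x \<and> f 1 = y}"

definition dipath_space :: "'a dispace \<Rightarrow> 'a \<Rightarrow> 'a \<Rightarrow> (real \<Rightarrow> 'a) topology" where
  "dipath_space X x y =
    subtopology (compact_open_topology (top_of_set {0..1}) (dtop X)) (dipaths X x y)"

text \<open>Non-decreasing continuous surjections fix the endpoints, so the equivalence relation
  can be generated on all dipaths at once: the class of a dipath from \<open>x\<close> to \<open>y\<close>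
  consists of dipaths from \<open>x\<close> to \<open>y\<close>.\<close>

definition reparam_step :: "'a dispace \<Rightarrow> (real \<Rightarrow> 'a) \<Rightarrow> (real \<Rightarrow> 'a) \<Rightarrow> bool" where
  "reparam_step X f g \<longleftrightarrow>
    f \<in> dpaths X \<and> g \<in> dpaths X \<and>
    (\<exists>\<phi>. monotone_reparam \<phi> \<and> \<phi> ` {0..1} = {0..1} \<and> g = compose {0..1} f \<phi>)"

type_synonym 'a trace = "(real \<Rightarrow> 'a) set"

definition trace_class :: "'a dispace \<Rightarrow> (real \<Rightarrow> 'a) \<Rightarrow> 'a trace" where
  "trace_class X f = {g. equivclp (reparam_step X) f g}"

definition traces :: "'a dispace \<Rightarrow> 'a \<Rightarrow> 'a \<Rightarrow> 'a trace set" where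
  "traces X x y = trace_class X ` dipaths X x y"

definition trace_space :: "'a dispace \<Rightarrow> 'a \<Rightarrow> 'a \<Rightarrow> 'a trace topology" where
  "trace_space X x y = quotient_topology (dipath_space X x y) (trace_class X)"

text \<open>Operations on equivalence classes are defined as unions over all representatives;
  they are meaningful because the class of the result does not depend on the representatives.\<close>

definition trace_id :: "'a dispace \<Rightarrow> 'a \<Rightarrow> 'a trace" where
  "trace_id X x = trace_class X (const_path x)"

definition trace_concat :: "'a dispace \<Rightarrow> 'a trace \<Rightarrow> 'a trace \<Rightarrow> 'a trace" where
  "trace_concat X f g = (\<Union>p \<in> f. \<Union>q \<in> g. trace_class X (path_concat p q))"

definition trace_map :: "'a dispace \<Rightarrow> ('a \<Rightarrow> 'a) \<Rightarrow> 'a trace \<Rightarrow> 'a trace" where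
  "trace_map Y \<phi> f = (\<Union>p \<in> f. trace_class Y (compose {0..1} \<phi> p))"


section \<open>Homotopy groups\<close>

text \<open>For \<open>m \<ge> 1\<close>, the underlying set of the \<open>m\<close>-th homotopy group of \<open>T\<close> at \<open>b\<close> is the set of
  homotopy classes, relative to the boundary, of maps from the \<open>m\<close>-cube to \<open>T\<close> with constant
  value \<open>b\<close> on the boundary.  The values of a representative outside of the cube are arbitrary
  and do not affect its class.\<close>

definition cube :: "nat \<Rightarrow> (nat \<Rightarrow> real) topology" where
  "cube m = product_topology (\<lambda>i. top_of_set {0..1}) {..<m}"

definition cube_boundary :: "nat \<Rightarrow> (nat \<Rightarrow> real) set" where
  "cube_boundary m = {u \<in> topspace (cube m). \<exists>i<m. u i = 0 \<or> u i = 1}"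

definition cube_maps :: "nat \<Rightarrow> 'b topology \<Rightarrow> 'b \<Rightarrow> ((nat \<Rightarrow> real) \<Rightarrow> 'b) set" where
  "cube_maps m T b = {s. continuous_map (cube m) T s \<and> (\<forall>u \<in> cube_boundary m. s u = b)}"

definition homotopy_class ::
  "nat \<Rightarrow> 'b topology \<Rightarrow> 'b \<Rightarrow> ((nat \<Rightarrow> real) \<Rightarrow> 'b) \<Rightarrow> ((nat \<Rightarrow> real) \<Rightarrow> 'b) set" where
  "homotopy_class m T b s =
    {s'. homotopic_with (\<lambda>h. \<forall>u \<in> cube_boundary m. h u = b) (cube m) T s s'}"

definition homotopy_group ::
  "nat \<Rightarrow> 'b topology \<Rightarrow> 'b \<Rightarrow> ((nat \<Rightarrow> real) \<Rightarrow> 'b) set set" where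
  "homotopy_group m T b = homotopy_class m T b ` cube_maps m T b"


section \<open>Natural homotopy\<close>

text \<open>The three constructors hold the elements for \<open>n = 0\<close>, \<open>n = 1\<close> and \<open>n \<ge> 2\<close>, respectively.\<close>

datatype 'a nat_htpy =
    Point "'a trace"
  | Component "'a trace set"
  | Sphere "((nat \<Rightarrow> real) \<Rightarrow> 'a trace) set"

definition nat_htpy_set ::
  "nat \<Rightarrow> 'a dispace \<Rightarrow> 'a \<Rightarrow> 'a \<Rightarrow> 'a trace \<Rightarrow> 'a nat_htpy set" where
  "nat_htpy_set n X x y f =
    (if n = 0 then {Point f}
     else if n = 1 then Component ` path_components_of (trace_space X x y)
     else Sphere ` homotopy_group (n - 1) (trace_space X x y) f)"

definition nat_htpy_base ::
  "nat \<Rightarrow> 'a dispace \<Rightarrow> 'a \<Rightarrow> 'a \<Rightarrow> 'a trace \<Rightarrow> 'a nat_htpy" where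
  "nat_htpy_base n X x y f =
    (if n = 0 then Point f
     else if n = 1 then Component (path_component_of_set (trace_space X x y) f)
     else Sphere (homotopy_class (n - 1) (trace_space X x y) f (\<lambda>u. f)))"

text \<open>In the next two functions, \<open>f\<close> and \<open>g\<close> are the traces at which the arguments live.\<close>

fun nat_htpy_concat ::
  "nat \<Rightarrow> 'a dispace \<Rightarrow> 'a \<Rightarrow> 'a \<Rightarrow> 'a trace \<Rightarrow> 'a trace
    \<Rightarrow> 'a nat_htpy \<Rightarrow> 'a nat_htpy \<Rightarrow> 'a nat_htpy" where
  "nat_htpy_concat n X x z f g (Point f') (Point g') = Point (trace_concat X f' g')"
| "nat_htpy_concat n X x z f g (Component A) (Component B) =
    Component (\<Union>a \<in> A. \<Union>b \<in> B. path_component_of_set (trace_space X x z) (trace_concat X a b))"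
| "nat_htpy_concat n X x z f g (Sphere \<sigma>) (Sphere \<tau>) =
    Sphere (\<Union>s \<in> \<sigma>. \<Union>t \<in> \<tau>.
      homotopy_class (n - 1) (trace_space X x z) (trace_concat X f g)
        (\<lambda>u. trace_concat X (s u) (t u)))"

text \<open>The target dispace is \<open>Y\<close>, and \<open>x\<close>, \<open>y\<close> are the endpoints of \<open>f\<close> in the source.\<close>

fun nat_htpy_map ::
  "nat \<Rightarrow> 'a dispace \<Rightarrow> ('a \<Rightarrow> 'a) \<Rightarrow> 'a \<Rightarrow> 'a \<Rightarrow> 'a trace \<Rightarrow> 'a nat_htpy \<Rightarrow> 'a nat_htpy" where
  "nat_htpy_map n Y \<phi> x y f (Point f') = Point (trace_map Y \<phi> f')"
| "nat_htpy_map n Y \<phi> x y f (Component A) =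
    Component (\<Union>a \<in> A. path_component_of_set (trace_space Y (\<phi> x) (\<phi> y)) (trace_map Y \<phi> a))"
| "nat_htpy_map n Y \<phi> x y f (Sphere \<sigma>) =
    Sphere (\<Union>s \<in> \<sigma>.
      homotopy_class (n - 1) (trace_space Y (\<phi> x) (\<phi> y)) (trace_map Y \<phi> f)
        (\<lambda>u. trace_map Y \<phi> (s u)))"

definition nat_htpy_cat :: "nat \<Rightarrow> 'a dispace \<Rightarrow> ('a, 'a nat_htpy \<times> 'a trace) cat" where
  "nat_htpy_cat n X =
    \<lparr>obj = topspace (dtop X),
     hom = (\<lambda>x y. {(\<sigma>, f). f \<in> traces X x y \<and> \<sigma> \<in> nat_htpy_set n X x y f}),
     ident = (\<lambda>x. (nat_htpy_base n X x x (trace_id X x), trace_id X x)),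
     cmp = (\<lambda>x y z (\<sigma>, f) (\<tau>, g). (nat_htpy_concat n X x z f g \<sigma> \<tau>, trace_concat X f g))\<rparr>"

definition nat_htpy_cat_map ::
  "nat \<Rightarrow> 'a dispace \<Rightarrow> 'a dispace \<Rightarrow> ('a \<Rightarrow> 'a)
    \<Rightarrow> ('a, 'a nat_htpy \<times> 'a trace, 'a, 'a nat_htpy \<times> 'a trace) funct" where
  "nat_htpy_cat_map n X Y \<phi> =
    \<lparr>omap = (\<lambda>x \<in> topspace (dtop X). \<phi> x),
     mmap = (\<lambda>x y. \<lambda>(\<sigma>, f) \<in> hom (nat_htpy_cat n X) x y.
       (nat_htpy_map n Y \<phi> x y f \<sigma>, trace_map Y \<phi> f))\<rparr>"

definition nat_htpy_functor ::
  "nat \<Rightarrow> ('a dispace, 'a \<Rightarrow> 'a, ('a, 'a nat_htpy \<times> 'a trace) cat,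
    ('a, 'a nat_htpy \<times> 'a trace, 'a, 'a nat_htpy \<times> 'a trace) funct) funct" where
  "nat_htpy_functor n = \<lparr>omap = nat_htpy_cat n, mmap = nat_htpy_cat_map n\<rparr>"


section \<open>Strong time-reversal\<close>

definition strongly_time_reversal ::
  "('a dispace, 'a \<Rightarrow> 'a, ('o, 'm) cat, ('o, 'm, 'o, 'm) funct) funct \<Rightarrow> bool" where
  "strongly_time_reversal F \<longleftrightarrow>
    is_functor dTop Cat F \<and>
    (\<exists>\<eta>. natural_isomorphism dTop Cat
      (funct_comp F reversal_functor) (funct_comp op_functor F) \<eta>)"

end

theory Submission
  imports Defs
begin

text \<open>Reversing paths identifies the trace spaces of \<open>X\<^sup>\<sharp>\<close> from \<open>x\<close> to \<open>y\<close> with those of \<open>X\<close> from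
  \<open>y\<close> to \<open>x\<close> and turns \<open>f \<star> g\<close> into \<open>g\<^sup>\<sharp> \<star> f\<^sup>\<sharp>\<close>; the natural isomorphism applies this to both
  components of a morphism.  The delicate point is that composition is defined at all for
  \<open>n \<ge> 2\<close>: this needs joint continuity of concatenation on the product of two trace spaces, which carry
  quotient topologies.  It holds because the projection from dipaths to traces is open.\<close>

section \<open>Reparametrizations\<close>

text \<open>Openness of the projection would be immediate if the reparametrizations formed a group
  acting on dipaths. They form only a monoid: a non-decreasing surjection may be constant on
  intervals, and then no reparametrization is a right inverse of it. An approximate right inverse
  exists, and the compact-open topology absorbs its error because only compact sets of parameters
  are tested. Openness, unlike being a quotient map, passes to products. \<open>Cat\<close> compares
  functors by equality, so nothing may hold merely up to homotopy. The laws are strict because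
  passing to traces turns reassociation and waiting at an endpoint into equalities, and because
  reversal is a strict involution on dispaces and on traces. The component at \<open>X\<close> is
  the reversal functor of \<open>opp_dispace X\<close>; its inverse is the image under
  \<open>op_functor\<close> of the reversal functor of \<open>X\<close>.\<close>

definition surj_reparam :: "(real \<Rightarrow> real) \<Rightarrow> bool" where
  "surj_reparam \<phi> \<longleftrightarrow> monotone_reparam \<phi> \<and> \<phi> ` {0..1} = {0..1}"

text \<open>Monotonicity and the two end values confine the range to \<open>{0..1}\<close>, and the
  intermediate value theorem gives surjectivity. Surjective reparametrizations written down later
  are checked through this rule.\<close>

lemma surj_reparamI:
  assumes cont: "continuous_on {0..1} \<phi>" and mono: "mono_on {0..1} \<phi>"
    and ends: "\<phi> 0 = 0" "\<phi> 1 = 1"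
  shows "surj_reparam \<phi>"
proof -
  have in01: "\<phi> t \<in> {0..1}" if "t \<in> {0..1}" for t
    using that mono_onD[OF mono, of 0 t] mono_onD[OF mono, of t 1] ends by auto
  moreover have "t \<in> \<phi> ` {0..1}" if "t \<in> {0..1}" for t
    using IVT'[of \<phi> 0 t 1] that ends cont by fastforce
  ultimately show ?thesis
    using cont mono by (auto simp: surj_reparam_def monotone_reparam_def)
qed

text \<open>Surjectivity supplies preimages of 0 and 1, and monotonicity pushes these values out to
  the ends of the interval. Fixed ends keep a reparametrized dipath in the same space of
  dipaths.\<close>

lemma
  assumes "surj_reparam \<phi>"
  shows surj_reparam_continuous: "continuous_on {0..1} \<phi>"
    and surj_reparam_mono: "mono_on {0..1} \<phi>"
    and surj_reparam_in: "t \<in> {0..1} \<Longrightarrow> \<phi> t \<in> {0..1}"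
    and surj_reparam_0 [simp]: "\<phi> 0 = 0"
    and surj_reparam_1 [simp]: "\<phi> 1 = 1"
proof -
  show mono: "mono_on {0..1} \<phi>" and "continuous_on {0..1} \<phi>"
    using assms by (auto simp: surj_reparam_def monotone_reparam_def)
  show in01: "\<phi> t \<in> {0..1}" if "t \<in> {0..1}" for t
    using assms that by (auto simp: surj_reparam_def monotone_reparam_def)
  obtain a b where "a \<in> {0..1}" "\<phi> a = 0" "b \<in> {0..1}" "\<phi> b = 1"
    using assms unfolding surj_reparam_def
    by (metis (no_types, lifting) atLeastAtMost_iff imageE order_refl zero_le_one)
  then show "\<phi> 0 = 0" "\<phi> 1 = 1"
    using mono_onD[OF mono, of 0 a] mono_onD[OF mono, of b 1] in01[of 0] in01[of 1] by auto
qed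

lemma surj_reparam_id: "surj_reparam (\<lambda>t. t)"
  by (auto intro!: surj_reparamI mono_onI continuous_intros)

lemma surj_reparam_comp:
  assumes \<phi>: "surj_reparam \<phi>" and \<psi>: "surj_reparam \<psi>"
  shows "surj_reparam (\<lambda>t. \<phi> (\<psi> t))"
proof (rule surj_reparamI)
  show "continuous_on {0..1} (\<lambda>t. \<phi> (\<psi> t))"
    using surj_reparam_in[OF \<psi>]
    by (intro continuous_on_compose2[OF surj_reparam_continuous[OF \<phi>]]
        surj_reparam_continuous[OF \<psi>]) blast
  show "mono_on {0..1} (\<lambda>t. \<phi> (\<psi> t))"
    using mono_onD[OF surj_reparam_mono[OF \<phi>]] mono_onD[OF surj_reparam_mono[OF \<psi>]]
      surj_reparam_in[OF \<psi>] by (intro mono_onI) blast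
qed (use assms in simp_all)

text \<open>Conjugation by \<open>1 - t\<close>: this is the reparametrization that acts on a
  reversed path when \<open>\<phi>\<close> acts on the original one.\<close>

lemma surj_reparam_flip:
  assumes \<phi>: "surj_reparam \<phi>"
  shows "surj_reparam (\<lambda>t. 1 - \<phi> (1 - t))"
proof (rule surj_reparamI)
  show "continuous_on {0..1} (\<lambda>t. 1 - \<phi> (1 - t))"
    by (intro continuous_intros continuous_on_compose2[OF surj_reparam_continuous[OF \<phi>]]) auto
  show "mono_on {0..1} (\<lambda>t. 1 - \<phi> (1 - t))"
    by (intro mono_onI) (use mono_onD[OF surj_reparam_mono[OF \<phi>]] in fastforce)
qed (use \<phi> in simp_all)

text \<open>The two maps are run on the two halves of the interval; at \<open>1/2\<close> they agree
  since \<open>\<phi> 1 = 1\<close> and \<open>\<psi> 0 = 0\<close>. This single reparametrization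
  realizes independent reparametrizations of the two factors of a concatenation.\<close>

lemma surj_reparam_join:
  assumes \<phi>: "surj_reparam \<phi>" and \<psi>: "surj_reparam \<psi>"
  shows "surj_reparam (\<lambda>t. if t \<le> 1/2 then \<phi> (2 * t) / 2 else 1/2 + \<psi> (2 * t - 1) / 2)"
    (is "surj_reparam ?\<kappa>")
proof (rule surj_reparamI)
  have "continuous_on ({0..1/2} \<union> {1/2..1}) ?\<kappa>"
  proof (rule continuous_on_cases)
    show "continuous_on {0..1/2} (\<lambda>t. \<phi> (2 * t) / 2)"
      by (intro continuous_intros continuous_on_compose2[OF surj_reparam_continuous[OF \<phi>]]) auto
    show "continuous_on {1/2..1} (\<lambda>t. 1/2 + \<psi> (2 * t - 1) / 2)"
      by (intro continuous_intros continuous_on_compose2[OF surj_reparam_continuous[OF \<psi>]]) auto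
    show "\<forall>t. t \<in> {0..1/2} \<and> \<not> t \<le> 1/2 \<or> t \<in> {1/2..1} \<and> t \<le> 1/2 \<longrightarrow>
        \<phi> (2 * t) / 2 = 1/2 + \<psi> (2 * t - 1) / 2"
    proof (intro allI impI)
      fix t :: real assume "t \<in> {0..1/2} \<and> \<not> t \<le> 1/2 \<or> t \<in> {1/2..1} \<and> t \<le> 1/2"
      then have t: "2 * t = 1" by auto
      show "\<phi> (2 * t) / 2 = 1/2 + \<psi> (2 * t - 1) / 2" unfolding t using \<phi> \<psi> by simp
    qed
  qed auto
  moreover have "{0..1/2} \<union> {1/2..1} = {0..1::real}" by auto
  ultimately show "continuous_on {0..1} ?\<kappa>" by simp
  show "mono_on {0..1} ?\<kappa>"
  proof (rule mono_onI)
    fix r s :: real assume rs: "r \<in> {0..1}" "s \<in> {0..1}" "r \<le> s"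
    consider "s \<le> 1/2" | "r \<le> 1/2" "1/2 < s" | "1/2 < r" by linarith
    then show "?\<kappa> r \<le> ?\<kappa> s"
    proof cases
      case 1 then show ?thesis
        using rs mono_onD[OF surj_reparam_mono[OF \<phi>], of "2 * r" "2 * s"] by auto
    next
      case 2 then show ?thesis
        using rs surj_reparam_in[OF \<phi>, of "2 * r"] surj_reparam_in[OF \<psi>, of "2 * s - 1"] by auto
    next
      case 3 then show ?thesis
        using rs mono_onD[OF surj_reparam_mono[OF \<psi>], of "2 * r - 1" "2 * s - 1"] by auto
    qed
  qed
qed (use assms in simp_all)

text \<open>The witness is the inverse of the strictly increasing map \<open>(1 - \<epsilon>) \<phi> + \<epsilon> id\<close>.\<close>

lemma surj_reparam_approx_section:
  assumes \<phi>: "surj_reparam \<phi>" and "\<epsilon> > 0"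
  obtains s where "surj_reparam s" "\<And>u. u \<in> {0..1} \<Longrightarrow> \<bar>\<phi> (s u) - u\<bar> \<le> \<epsilon>"
proof -
  \<comment> \<open>Capping at 1 keeps \<open>1 - e\<close> nonnegative, so the term with
    \<open>\<phi>\<close> stays non-decreasing while \<open>e * t\<close> makes the sum strictly
    increasing.\<close>
  define e where "e = min \<epsilon> 1"
  have e: "0 < e" "e \<le> 1" "e \<le> \<epsilon>" using \<open>\<epsilon> > 0\<close> by (auto simp: e_def)
  define \<kappa> where "\<kappa> = (\<lambda>t. (1 - e) * \<phi> t + e * t)"
  have less: "\<kappa> r < \<kappa> t" if "r \<in> {0..1}" "t \<in> {0..1}" "r < t" for r t
  proof -
    have "(1 - e) * \<phi> r \<le> (1 - e) * \<phi> t"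
      using mono_onD[OF surj_reparam_mono[OF \<phi>], of r t] that e by (intro mult_left_mono) auto
    then show ?thesis using that e by (simp add: \<kappa>_def add_le_less_mono)
  qed
  have cont: "continuous_on {0..1} \<kappa>"
    unfolding \<kappa>_def by (intro continuous_intros surj_reparam_continuous[OF \<phi>])
  have "surj_reparam \<kappa>"
  proof (rule surj_reparamI[OF cont])
    show "mono_on {0..1} \<kappa>" using less by (intro mono_onI) (metis less_eq_real_def)
  qed (use \<phi> in \<open>simp_all add: \<kappa>_def\<close>)
  then have img: "\<kappa> ` {0..1} = {0..1}" by (simp add: surj_reparam_def)
  have inj: "inj_on \<kappa> {0..1}"
    by (rule inj_onI) (metis less less_irrefl linorder_neqE)
  define s where "s = inv_into {0..1} \<kappa>"
  have s\<kappa>: "s (\<kappa> t) = t" if "t \<in> {0..1}" for t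
    using inj that by (simp add: s_def)
  have \<kappa>s: "\<kappa> (s u) = u" and s_in: "s u \<in> {0..1}" if "u \<in> {0..1}" for u
    using that img f_inv_into_f[of u \<kappa> "{0..1}"] inv_into_into[of u \<kappa> "{0..1}"] by (auto simp: s_def)
  have "surj_reparam s"
  proof (rule surj_reparamI)
    show "continuous_on {0..1} s"
      using continuous_on_inv[OF cont compact_Icc] s\<kappa> img by simp
    show "mono_on {0..1} s"
    proof (rule mono_onI)
      fix r t :: real assume "r \<in> {0..1}" "t \<in> {0..1}" "r \<le> t"
      then show "s r \<le> s t"
        using less[of "s t" "s r"] \<kappa>s[of r] \<kappa>s[of t] s_in[of r] s_in[of t] by (cases "s t < s r") auto
    qed
    show "s 0 = 0" "s 1 = 1" using s\<kappa>[of 0] s\<kappa>[of 1] \<open>surj_reparam \<kappa>\<close> by simp_all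
  qed
  moreover have "\<bar>\<phi> (s u) - u\<bar> \<le> \<epsilon>" if "u \<in> {0..1}" for u
  proof -
    \<comment> \<open>This is \<open>\<kappa> (s u) = u\<close> solved for the error. Both points on
      the right lie in the unit interval, so the error is at most \<open>e\<close>.\<close>
    have "\<phi> (s u) - u = e * (\<phi> (s u) - s u)"
      using \<kappa>s[OF that] by (simp add: \<kappa>_def algebra_simps)
    then have "\<bar>\<phi> (s u) - u\<bar> = e * \<bar>\<phi> (s u) - s u\<bar>" using e by (simp add: abs_mult)
    also have "\<dots> \<le> e * 1"
      using s_in[OF that] surj_reparam_in[OF \<phi> s_in[OF that]] e by (intro mult_left_mono) auto
    finally show ?thesis using e by simp
  qed
  ultimately show thesis by (rule that)
qed


section \<open>Traces\<close>

lemma reparam_step_iff: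
  "reparam_step X f g \<longleftrightarrow>
    f \<in> dpaths X \<and> g \<in> dpaths X \<and> (\<exists>\<phi>. surj_reparam \<phi> \<and> g = compose {0..1} f \<phi>)"
  by (auto simp: reparam_step_def surj_reparam_def)

lemma
  assumes "is_dispace X"
  shows dpaths_pathin: "f \<in> dpaths X \<Longrightarrow> pathin (dtop X) f"
    and dpaths_extensional: "f \<in> dpaths X \<Longrightarrow> f \<in> extensional {0..1}"
    and dpaths_const: "x \<in> topspace (dtop X) \<Longrightarrow> const_path x \<in> dpaths X"
    and dpaths_reparam: "f \<in> dpaths X \<Longrightarrow> monotone_reparam \<phi> \<Longrightarrow> compose {0..1} f \<phi> \<in> dpaths X"
    and dpaths_concat:
      "f \<in> dpaths X \<Longrightarrow> g \<in> dpaths X \<Longrightarrow> f 1 = g 0 \<Longrightarrow> path_concat f g \<in> dpaths X"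
  using assms by (auto simp: is_dispace_def)

lemma dpaths_in_topspace:
  assumes "is_dispace X" "f \<in> dpaths X" "t \<in> {0..1}"
  shows "f t \<in> topspace (dtop X)"
  using dpaths_pathin[OF assms(1,2)] assms(3)
  by (auto simp: pathin_def continuous_map_def)

lemma path_concat_0 [simp]: "path_concat f g 0 = f 0"
  and path_concat_1 [simp]: "path_concat f g 1 = g 1"
  and path_reverse_0 [simp]: "path_reverse f 0 = f 1"
  and path_reverse_1 [simp]: "path_reverse f 1 = f 0"
  and const_path_0 [simp]: "const_path x 0 = x"
  and const_path_1 [simp]: "const_path x 1 = x"
  by (simp_all add: path_concat_def path_reverse_def const_path_def)

lemma reparam_step_compose:
  assumes "is_dispace X" "f \<in> dpaths X" "surj_reparam \<phi>"
  shows "reparam_step X f (compose {0..1} f \<phi>)"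
  using assms dpaths_reparam by (auto simp: reparam_step_iff surj_reparam_def)

lemma compose_surj_reparam_in_dipaths:
  assumes "is_dispace X" "f \<in> dipaths X x y" "surj_reparam \<phi>"
  shows "compose {0..1} f \<phi> \<in> dipaths X x y"
  using assms dpaths_reparam by (auto simp: dipaths_def surj_reparam_def[of \<phi>] compose_def)

lemma trace_class_eq: "trace_class X f = trace_class X g \<longleftrightarrow> equivclp (reparam_step X) f g"
proof
  assume "trace_class X f = trace_class X g"
  moreover have "g \<in> trace_class X g" by (simp add: trace_class_def)
  ultimately have "g \<in> trace_class X f" by simp
  then show "equivclp (reparam_step X) f g" by (simp add: trace_class_def)
next
  assume fg: "equivclp (reparam_step X) f g"
  have "equivclp (reparam_step X) f h \<longleftrightarrow> equivclp (reparam_step X) g h" for h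
    using equivclp_trans[OF fg] equivclp_trans[OF equivclp_sym[OF fg]] by blast
  then show "trace_class X f = trace_class X g"
    by (simp add: trace_class_def)
qed

lemma trace_class_self [simp]: "f \<in> trace_class X f"
  by (simp add: trace_class_def)

lemma mem_trace_class: "g \<in> trace_class X f \<longleftrightarrow> trace_class X g = trace_class X f"
  unfolding trace_class_eq by (metis equivclp_sym mem_Collect_eq trace_class_def)

lemma trace_class_compose:
  assumes "is_dispace X" "f \<in> dpaths X" "surj_reparam \<phi>"
  shows "trace_class X (compose {0..1} f \<phi>) = trace_class X f"
  using reparam_step_compose[OF assms] by (auto simp: trace_class_eq)

lemma reparam_step_dipaths: "reparam_step X f g \<Longrightarrow> f \<in> dipaths X x y \<longleftrightarrow> g \<in> dipaths X x y"
  by (auto simp: reparam_step_iff dipaths_def compose_def)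

text \<open>Induction along the zigzag that generates the class. Membership in
  \<open>dipaths X x y\<close> travels along with the invariant, so the step condition may assume
  it. Well-definedness of concatenation, of induced maps and of reversal is deduced from
  here.\<close>

lemma trace_class_lift:
  assumes "g \<in> trace_class X f" and "f \<in> dipaths X x y"
    and step: "\<And>p q. p \<in> dipaths X x y \<Longrightarrow> q \<in> dipaths X x y \<Longrightarrow> reparam_step X p q \<Longrightarrow> F p = F q"
  shows "g \<in> dipaths X x y \<and> F g = F f"
proof -
  have "equivclp (reparam_step X) f g" using assms(1) by (simp add: trace_class_def)
  then show ?thesis
  proof (induction rule: equivclp_induct)
    case base show ?case using assms(2) by simp
  next
    case (step g h)
    then have "h \<in> dipaths X x y" by (meson reparam_step_dipaths)
    with step show ?case by (metis assms(3))
  qed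
qed

lemma trace_class_dipaths:
  "f \<in> dipaths X x y \<Longrightarrow> g \<in> trace_class X f \<Longrightarrow> g \<in> dipaths X x y"
  \<comment> \<open>Only the membership half is wanted; a constant \<open>F\<close> makes the step
    condition trivial.\<close>
  using trace_class_lift[where F = "\<lambda>_. undefined"] by metis

lemma path_concat_dipaths:
  assumes "is_dispace X" "f \<in> dipaths X x y" "g \<in> dipaths X y z"
  shows "path_concat f g \<in> dipaths X x z"
  using assms dpaths_concat[OF assms(1)] by (auto simp: dipaths_def)

lemma path_concat_compose:
  assumes "surj_reparam \<phi>" "surj_reparam \<psi>" "f 1 = g 0"
  shows "path_concat (compose {0..1} f \<phi>) (compose {0..1} g \<psi>) =
    compose {0..1} (path_concat f g)
      (\<lambda>t. if t \<le> 1/2 then \<phi> (2 * t) / 2 else 1/2 + \<psi> (2 * t - 1) / 2)"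
proof
  fix t :: real
  show "path_concat (compose {0..1} f \<phi>) (compose {0..1} g \<psi>) t =
    compose {0..1} (path_concat f g)
      (\<lambda>t. if t \<le> 1/2 then \<phi> (2 * t) / 2 else 1/2 + \<psi> (2 * t - 1) / 2) t"
    using surj_reparam_in[OF assms(1), of "2 * t"] surj_reparam_in[OF assms(2), of "2 * t - 1"] assms(3)
    \<comment> \<open>A plateau of \<open>\<psi>\<close> at 0 holds the joined map at
      \<open>1/2\<close> for some time after \<open>t = 1/2\<close>. There
      \<open>path_concat f g\<close> reads its first branch, \<open>f 1\<close>, while the left side
      reads \<open>g 0\<close>; hence the condition \<open>f 1 = g 0\<close>.\<close>
    by (cases "\<psi> (2 * t - 1) = 0") (auto simp: path_concat_def compose_def)
qed

lemma compose_id_path: "f \<in> extensional {0..1} \<Longrightarrow> compose {0..1} f (\<lambda>t. t) = f"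
  by (auto simp: compose_def extensional_def fun_eq_iff)

lemma reparam_step_concat:
  assumes X: "is_dispace X" and "reparam_step X f f'" "reparam_step X g g'" "f 1 = g 0"
  shows "trace_class X (path_concat f' g') = trace_class X (path_concat f g)"
proof -
  obtain \<phi> \<psi> where "surj_reparam \<phi>" "f' = compose {0..1} f \<phi>"
      "surj_reparam \<psi>" "g' = compose {0..1} g \<psi>"
    using assms by (auto simp: reparam_step_iff)
  then show ?thesis
    using assms dpaths_concat[OF X] trace_class_compose[OF X _ surj_reparam_join]
    by (simp only: path_concat_compose reparam_step_iff)
qed

text \<open>The identity reparametrization gives back \<open>f\<close> itself because dipaths are
  extensional. Reflexive steps allow one factor of a concatenation to be changed while the other
  stays fixed.\<close>

lemma reparam_step_refl:
  assumes "is_dispace X" "f \<in> dpaths X" shows "reparam_step X f f"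
  using reparam_step_compose[OF assms surj_reparam_id] dpaths_extensional[OF assms]
  by (simp add: compose_id_path)

text \<open>The factors are replaced one after the other. The second replacement takes place next to
  \<open>f'\<close>, so the first one must also deliver that \<open>f'\<close> is a dipath with the
  same ends.\<close>

lemma trace_class_concat:
  assumes X: "is_dispace X" and f: "f \<in> dipaths X x y" and g: "g \<in> dipaths X y z"
    and f': "f' \<in> trace_class X f" and g': "g' \<in> trace_class X g"
  shows "trace_class X (path_concat f' g') = trace_class X (path_concat f g)"
proof -
  have *: "f' \<in> dipaths X x y \<and>
      trace_class X (path_concat f' g) = trace_class X (path_concat f g)"
  proof (rule trace_class_lift[OF f' f, where F = "\<lambda>p. trace_class X (path_concat p g)"])
    fix p q assume "p \<in> dipaths X x y" "reparam_step X p q"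
    then show "trace_class X (path_concat p g) = trace_class X (path_concat q g)"
      using g reparam_step_concat[OF X, of p q g g] reparam_step_refl[OF X, of g]
      by (simp add: dipaths_def)
  qed
  moreover have "g' \<in> dipaths X y z \<and>
      trace_class X (path_concat f' g') = trace_class X (path_concat f' g)"
  proof (rule trace_class_lift[OF g' g, where F = "\<lambda>q. trace_class X (path_concat f' q)"])
    fix p q assume "p \<in> dipaths X y z" "reparam_step X p q"
    then show "trace_class X (path_concat f' p) = trace_class X (path_concat f' q)"
      using * reparam_step_concat[OF X, of f' f' p q] reparam_step_refl[OF X, of f']
      by (simp add: dipaths_def)
  qed
  ultimately show ?thesis by simp
qed

text \<open>All members of the union that defines \<open>trace_concat\<close> coincide, and there is
  at least one since a class contains its own representative.\<close>

lemma trace_concat_class: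
  assumes "is_dispace X" "f \<in> dipaths X x y" "g \<in> dipaths X y z"
  shows "trace_concat X (trace_class X f) (trace_class X g) = trace_class X (path_concat f g)"
  using trace_class_concat[OF assms] trace_class_self[of f X] trace_class_self[of g X]
  unfolding trace_concat_def by blast

lemma traces_cases:
  assumes "a \<in> traces X x y"
  obtains f where "f \<in> dipaths X x y" "a = trace_class X f"
  using assms by (auto simp: traces_def)

lemma traces_endpoints:
  assumes "is_dispace X" "a \<in> traces X x y"
  shows "x \<in> topspace (dtop X)" "y \<in> topspace (dtop X)"
  using assms dpaths_in_topspace[OF assms(1), of _ 0] dpaths_in_topspace[OF assms(1), of _ 1]
  by (auto simp: dipaths_def elim!: traces_cases)

lemma const_path_dipaths:
  "is_dispace X \<Longrightarrow> x \<in> topspace (dtop X) \<Longrightarrow> const_path x \<in> dipaths X x x"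
  by (simp add: dipaths_def dpaths_const)

lemma trace_id_in:
  "is_dispace X \<Longrightarrow> x \<in> topspace (dtop X) \<Longrightarrow> trace_id X x \<in> traces X x x"
  by (auto simp: trace_id_def traces_def const_path_dipaths)

text \<open>The minimum is the piecewise linear map with slopes 2, 1 and 1/2 that sends 0, 1/4, 1/2,
  1 to 0, 1/2, 3/4, 1. Written as a minimum of increasing affine maps it is visibly continuous and
  monotone, without gluing.\<close>

lemma path_concat_assoc:
  assumes "f 1 = g 0" "g 1 = h 0"
  shows "path_concat (path_concat f g) h =
    compose {0..1} (path_concat f (path_concat g h)) (\<lambda>t. min (2 * t) (min (t + 1/4) (t/2 + 1/2)))"
proof
  fix t :: real
  consider "t \<notin> {0..1}" | "0 \<le> t" "t \<le> 1/4" | "1/4 < t" "t \<le> 1/2" | "1/2 < t" "t \<le> 1"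
    by fastforce
  then show "path_concat (path_concat f g) h t = compose {0..1} (path_concat f (path_concat g h))
      (\<lambda>t. min (2 * t) (min (t + 1/4) (t/2 + 1/2))) t"
  proof cases
    case 2
    then have "min (2 * t) (min (t + 1/4) (t/2 + 1/2)) = 2 * t" by (auto simp: min_def)
    with 2 assms show ?thesis by (simp add: path_concat_def compose_def)
  next
    case 3
    then have "min (2 * t) (min (t + 1/4) (t/2 + 1/2)) = t + 1/4" by (auto simp: min_def)
    with 3 assms show ?thesis by (simp add: path_concat_def compose_def)
  next
    case 4
    then have "min (2 * t) (min (t + 1/4) (t/2 + 1/2)) = t/2 + 1/2" by (auto simp: min_def)
    with 4 assms show ?thesis by (simp add: path_concat_def compose_def)
  qed (auto simp: path_concat_def compose_def)
qed

lemma trace_concat_assoc: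
  assumes X: "is_dispace X" and "a \<in> traces X w x" "b \<in> traces X x y" "c \<in> traces X y z"
  shows "trace_concat X (trace_concat X a b) c = trace_concat X a (trace_concat X b c)"
proof -
  obtain f g h where fgh: "f \<in> dipaths X w x" "g \<in> dipaths X x y" "h \<in> dipaths X y z"
    and abc: "a = trace_class X f" "b = trace_class X g" "c = trace_class X h"
    using assms by (auto elim!: traces_cases)
  have fg: "path_concat f g \<in> dipaths X w y" and gh: "path_concat g h \<in> dipaths X x z"
    using fgh path_concat_dipaths[OF X] by blast+
  have "surj_reparam (\<lambda>t. min (2 * t) (min (t + 1/4) (t/2 + 1/2)))"
    by (rule surj_reparamI) (auto intro!: continuous_intros mono_onI)
  moreover have "path_concat f (path_concat g h) \<in> dpaths X"
    using path_concat_dipaths[OF X fgh(1) gh] by (simp add: dipaths_def)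
  ultimately have "trace_class X (path_concat (path_concat f g) h) =
      trace_class X (path_concat f (path_concat g h))"
    using fgh trace_class_compose[OF X] by (simp add: path_concat_assoc dipaths_def)
  then show ?thesis
    using trace_concat_class[OF X] fgh fg gh by (metis abc)
qed

text \<open>Waiting at an end is a plateau of the reparametrization. Since plateaus are allowed,
  constant paths become strict identities for traces.\<close>

lemma path_concat_const:
  assumes "f \<in> extensional {0..1}"
  shows path_concat_const_left: "f 0 = x \<Longrightarrow> path_concat (const_path x) f = compose {0..1} f (\<lambda>t. max 0 (2 * t - 1))"
    and path_concat_const_right: "f 1 = y \<Longrightarrow> path_concat f (const_path y) = compose {0..1} f (\<lambda>t. min 1 (2 * t))"
proof -
  have "t = 1/2" if "1 \<le> 2 * t" "t * 2 \<le> 1" for t :: real using that by simp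
  then show "f 0 = x \<Longrightarrow> path_concat (const_path x) f = compose {0..1} f (\<lambda>t. max 0 (2 * t - 1))"
    and "f 1 = y \<Longrightarrow> path_concat f (const_path y) = compose {0..1} f (\<lambda>t. min 1 (2 * t))"
    by (fastforce simp: path_concat_def const_path_def compose_def max_def min_def fun_eq_iff)+
qed

lemma
  assumes X: "is_dispace X" and a: "a \<in> traces X x y"
  shows trace_concat_id_left: "trace_concat X (trace_id X x) a = a"
    and trace_concat_id_right: "trace_concat X a (trace_id X y) = a"
proof -
  obtain f where f: "f \<in> dipaths X x y" and af: "a = trace_class X f"
    using a by (rule traces_cases)
  have xy: "const_path x \<in> dipaths X x x" "const_path y \<in> dipaths X y y"
    using const_path_dipaths[OF X] traces_endpoints[OF X a] by blast+
  have fd: "f \<in> dpaths X" "f 0 = x" "f 1 = y" using f by (auto simp: dipaths_def)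
  have "surj_reparam (\<lambda>t. max 0 (2 * t - 1))" "surj_reparam (\<lambda>t. min 1 (2 * t))"
    by (rule surj_reparamI; auto intro!: continuous_intros mono_onI)+
  then show "trace_concat X (trace_id X x) a = a" "trace_concat X a (trace_id X y) = a"
    using fd xy f trace_class_compose[OF X fd(1)] path_concat_const[OF dpaths_extensional[OF X fd(1)]]
    by (simp_all add: af trace_id_def trace_concat_class[OF X])
qed

lemma trace_concat_in:
  assumes "is_dispace X" "a \<in> traces X x y" "b \<in> traces X y z"
  shows "trace_concat X a b \<in> traces X x z"
  using assms path_concat_dipaths[OF assms(1)]
  by (auto simp: trace_concat_class[OF assms(1)] elim!: traces_cases) (auto simp: traces_def)


subsection \<open>Induced maps\<close>

lemma dmaps_topspace: "\<phi> \<in> dmaps X Y \<Longrightarrow> x \<in> topspace (dtop X) \<Longrightarrow> \<phi> x \<in> topspace (dtop Y)"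
  by (auto simp: dmaps_def dest: continuous_map_image_subset_topspace)

lemma dmaps_dipaths:
  "\<phi> \<in> dmaps X Y \<Longrightarrow> f \<in> dipaths X x y \<Longrightarrow> compose {0..1} \<phi> f \<in> dipaths Y (\<phi> x) (\<phi> y)"
  by (auto simp: dmaps_def dipaths_def compose_def)

lemma compose_path_assoc:
  assumes "surj_reparam \<theta>"
  shows "compose {0..1} \<phi> (compose {0..1} f \<theta>) = compose {0..1} (compose {0..1} \<phi> f) \<theta>"
  using surj_reparam_in[OF assms] by (auto simp: compose_def fun_eq_iff)

text \<open>Postcomposition commutes with reparametrization, so all representatives contribute the
  same class to the union.\<close>

lemma trace_map_class:
  assumes Y: "is_dispace Y" and \<phi>: "\<phi> \<in> dmaps X Y" and f: "f \<in> dipaths X x y"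
  shows "trace_map Y \<phi> (trace_class X f) = trace_class Y (compose {0..1} \<phi> f)"
proof -
  have "trace_class Y (compose {0..1} \<phi> g) = trace_class Y (compose {0..1} \<phi> f)"
    if "g \<in> trace_class X f" for g
  proof -
    have "g \<in> dipaths X x y \<and>
        trace_class Y (compose {0..1} \<phi> g) = trace_class Y (compose {0..1} \<phi> f)"
    proof (rule trace_class_lift[OF that f, where F = "\<lambda>p. trace_class Y (compose {0..1} \<phi> p)"])
      fix p q assume pq: "p \<in> dipaths X x y" "reparam_step X p q"
      then obtain \<theta> where "surj_reparam \<theta>" "q = compose {0..1} p \<theta>"
        by (auto simp: reparam_step_iff)
      then show "trace_class Y (compose {0..1} \<phi> p) = trace_class Y (compose {0..1} \<phi> q)"
        using dmaps_dipaths[OF \<phi> pq(1)]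
        by (auto simp: compose_path_assoc trace_class_compose[OF Y] dipaths_def)
    qed
    then show ?thesis by simp
  qed
  then show ?thesis unfolding trace_map_def using trace_class_self[of f X] by blast
qed

lemma trace_map_in:
  assumes "is_dispace Y" "\<phi> \<in> dmaps X Y" "a \<in> traces X x y"
  shows "trace_map Y \<phi> a \<in> traces Y (\<phi> x) (\<phi> y)"
  using assms by (auto simp: trace_map_class traces_def dmaps_dipaths elim!: traces_cases)

lemma trace_map_id:
  assumes X: "is_dispace X" and x: "x \<in> topspace (dtop X)"
    and Y: "is_dispace Y" and \<phi>: "\<phi> \<in> dmaps X Y"
  shows "trace_map Y \<phi> (trace_id X x) = trace_id Y (\<phi> x)"
proof -
  have "compose {0..1} \<phi> (const_path x) = const_path (\<phi> x)"
    by (auto simp: compose_def const_path_def)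
  then show ?thesis
    by (simp add: trace_id_def trace_map_class[OF Y \<phi> const_path_dipaths[OF X x]])
qed

lemma trace_map_concat:
  assumes X: "is_dispace X" and Y: "is_dispace Y" and \<phi>: "\<phi> \<in> dmaps X Y"
    and a: "a \<in> traces X x y" and b: "b \<in> traces X y z"
  shows "trace_map Y \<phi> (trace_concat X a b) = trace_concat Y (trace_map Y \<phi> a) (trace_map Y \<phi> b)"
proof -
  obtain f g where fg: "f \<in> dipaths X x y" "g \<in> dipaths X y z"
    and ab: "a = trace_class X f" "b = trace_class X g"
    using a b by (auto elim!: traces_cases)
  have "compose {0..1} \<phi> (path_concat f g) = path_concat (compose {0..1} \<phi> f) (compose {0..1} \<phi> g)"
    by (auto simp: compose_def path_concat_def fun_eq_iff)
  then show ?thesis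
    unfolding ab trace_concat_class[OF X fg] trace_map_class[OF Y \<phi> fg(1)] trace_map_class[OF Y \<phi> fg(2)]
      trace_map_class[OF Y \<phi> path_concat_dipaths[OF X fg]]
      trace_concat_class[OF Y dmaps_dipaths[OF \<phi> fg(1)] dmaps_dipaths[OF \<phi> fg(2)]]
    by simp
qed

text \<open>The identity of \<open>dTop\<close> is undefined off the carrier, but dipaths never
  leave the carrier, so composing with it returns the same path.\<close>

lemma trace_map_ident:
  assumes X: "is_dispace X" and a: "a \<in> traces X x y"
    and id: "(\<lambda>x\<in>topspace (dtop X). x) \<in> dmaps X X"
  shows "trace_map X (\<lambda>x\<in>topspace (dtop X). x) a = a"
proof -
  obtain f where f: "f \<in> dipaths X x y" and af: "a = trace_class X f"
    using a by (rule traces_cases)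
  then have "f \<in> dpaths X" by (simp add: dipaths_def)
  then have "compose {0..1} (\<lambda>x\<in>topspace (dtop X). x) f = f"
    using dpaths_in_topspace[OF X] dpaths_extensional[OF X]
    by (force simp: compose_def extensional_def fun_eq_iff)
  then show ?thesis by (simp add: af trace_map_class[OF X id f])
qed

lemma trace_map_compose:
  assumes X: "is_dispace X" and Y: "is_dispace Y" and Z: "is_dispace Z"
    and \<phi>: "\<phi> \<in> dmaps X Y" and \<psi>: "\<psi> \<in> dmaps Y Z"
    and \<psi>\<phi>: "compose (topspace (dtop X)) \<psi> \<phi> \<in> dmaps X Z" and a: "a \<in> traces X x y"
  shows "trace_map Z (compose (topspace (dtop X)) \<psi> \<phi>) a = trace_map Z \<psi> (trace_map Y \<phi> a)"
proof -
  obtain f where f: "f \<in> dipaths X x y" and af: "a = trace_class X f"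
    using a by (rule traces_cases)
  then have "f \<in> dpaths X" by (simp add: dipaths_def)
  then have "compose {0..1} (compose (topspace (dtop X)) \<psi> \<phi>) f =
      compose {0..1} \<psi> (compose {0..1} \<phi> f)"
    using dpaths_in_topspace[OF X] by (force simp: compose_def fun_eq_iff)
  then show ?thesis
    unfolding af trace_map_class[OF Y \<phi> f] trace_map_class[OF Z \<psi>\<phi> f]
      trace_map_class[OF Z \<psi> dmaps_dipaths[OF \<phi> f]] by simp
qed


subsection \<open>Time reversal\<close>

lemma path_reverse_eq_compose: "path_reverse f = compose {0..1} f (\<lambda>t. 1 - t)"
  by (simp add: path_reverse_def compose_def)

lemma path_reverse_involutive: "f \<in> extensional {0..1} \<Longrightarrow> path_reverse (path_reverse f) = f"
  by (auto simp: path_reverse_def extensional_def fun_eq_iff)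

lemma path_reverse_concat:
  assumes "f 1 = g 0"
  shows "path_reverse (path_concat f g) = path_concat (path_reverse g) (path_reverse f)"
proof
  fix t :: real
  show "path_reverse (path_concat f g) t = path_concat (path_reverse g) (path_reverse f) t"
    \<comment> \<open>Both sides switch branches at \<open>t = 1/2\<close>, where the left one reads
      \<open>f 1\<close> and the right one \<open>g 0\<close>.\<close>
    using assms by (cases "t = 1/2") (auto simp: path_reverse_def path_concat_def algebra_simps)
qed

lemma path_reverse_compose:
  assumes "surj_reparam \<phi>"
  shows "path_reverse (compose {0..1} f \<phi>) = compose {0..1} (path_reverse f) (\<lambda>t. 1 - \<phi> (1 - t))"
  using surj_reparam_in[OF assms] by (force simp: path_reverse_def compose_def)

lemma dpaths_opp_dispace [simp]: "dpaths (opp_dispace X) = path_reverse ` dpaths X"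
  and dtop_opp_dispace [simp]: "dtop (opp_dispace X) = dtop X"
  by (simp_all add: opp_dispace_def)

text \<open>An equality of dispaces and not only an isomorphism: double reversal restores each
  dipath exactly because dipaths are undefined off the unit interval.\<close>

lemma opp_opp_dispace:
  assumes "is_dispace X" shows "opp_dispace (opp_dispace X) = X"
proof -
  have "path_reverse ` path_reverse ` dpaths X = dpaths X"
    using path_reverse_involutive dpaths_extensional[OF assms] by (force simp: image_image)
  then show ?thesis by (simp add: opp_dispace_def)
qed

lemma is_dispace_opp:
  assumes X: "is_dispace X" shows "is_dispace (opp_dispace X)"
  unfolding is_dispace_def
proof (intro conjI ballI allI impI)
  fix f assume "f \<in> dpaths (opp_dispace X)"
  then obtain g where g: "g \<in> dpaths X" "f = path_reverse g" by auto
  have "continuous_map (top_of_set {0..1}) (top_of_set {0..1}) (\<lambda>t::real. 1 - t)"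
    by (auto intro!: continuous_intros)
  then have "continuous_map (top_of_set {0..1}) (dtop X) (g \<circ> (\<lambda>t. 1 - t))"
    using dpaths_pathin[OF X g(1)] unfolding pathin_def by (rule continuous_map_compose)
  then show "pathin (dtop (opp_dispace X)) f"
    unfolding pathin_def g(2) dtop_opp_dispace by (rule continuous_map_eq) (auto simp: path_reverse_def)
  show "f \<in> extensional {0..1}" by (simp add: g(2) path_reverse_def)
next
  fix x assume "x \<in> topspace (dtop (opp_dispace X))"
  then have "const_path x \<in> dpaths X" using dpaths_const[OF X] by simp
  moreover have "const_path x = path_reverse (const_path x)"
    by (auto simp: const_path_def path_reverse_def)
  ultimately show "const_path x \<in> dpaths (opp_dispace X)" by auto
next
  fix f \<phi> assume "f \<in> dpaths (opp_dispace X)" and \<phi>: "monotone_reparam \<phi>"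
  then obtain g where g: "g \<in> dpaths X" "f = path_reverse g" by auto
  \<comment> \<open>Closure under reparametrization concerns all monotone \<open>\<phi>\<close>,
    surjective or not, so the flip is verified directly rather than through
    \<open>surj_reparam_flip\<close>.\<close>
  have "monotone_reparam (\<lambda>t. 1 - \<phi> (1 - t))"
    unfolding monotone_reparam_def
  proof (intro conjI)
    show "continuous_on {0..1} (\<lambda>t. 1 - \<phi> (1 - t))"
      by (intro continuous_on_diff continuous_on_const continuous_on_compose2[of "{0..1}" \<phi> _ "\<lambda>t. 1 - t"])
        (use \<phi> in \<open>auto simp: monotone_reparam_def intro!: continuous_intros\<close>)
    show "(\<lambda>t. 1 - \<phi> (1 - t)) \<in> {0..1} \<rightarrow> {0..1}"
      using \<phi> by (force simp: monotone_reparam_def)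
    show "mono_on {0..1} (\<lambda>t. 1 - \<phi> (1 - t))"
      using \<phi> by (auto simp: monotone_reparam_def mono_on_def)
  qed
  then have "compose {0..1} g (\<lambda>t. 1 - \<phi> (1 - t)) \<in> dpaths X" by (rule dpaths_reparam[OF X g(1)])
  moreover have "compose {0..1} f \<phi> = path_reverse (compose {0..1} g (\<lambda>t. 1 - \<phi> (1 - t)))"
    using \<phi> by (force simp: g(2) path_reverse_def compose_def monotone_reparam_def)
  ultimately show "compose {0..1} f \<phi> \<in> dpaths (opp_dispace X)" by auto
next
  fix f g assume "f \<in> dpaths (opp_dispace X)" "g \<in> dpaths (opp_dispace X)" and fg: "f 1 = g 0"
  then obtain p q where pq: "p \<in> dpaths X" "f = path_reverse p" "q \<in> dpaths X" "g = path_reverse q"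
    by auto
  then have "path_concat f g = path_reverse (path_concat q p)"
    using fg by (simp add: path_reverse_concat)
  moreover have "path_concat q p \<in> dpaths X" using dpaths_concat[OF X] pq fg by simp
  ultimately show "path_concat f g \<in> dpaths (opp_dispace X)" by auto
qed

lemma path_reverse_dipaths: "f \<in> dipaths X x y \<Longrightarrow> path_reverse f \<in> dipaths (opp_dispace X) y x"
  by (auto simp: dipaths_def)

lemma reparam_step_reverse:
  "reparam_step X f g \<Longrightarrow> reparam_step (opp_dispace X) (path_reverse f) (path_reverse g)"
  using path_reverse_compose surj_reparam_flip by (fastforce simp: reparam_step_iff)

text \<open>A plain image suffices, with no dispace as parameter: the reversals of all members of a
  trace already form a full class in the opposite dispace.\<close>

definition trace_reverse :: "'a trace \<Rightarrow> 'a trace" where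
  "trace_reverse a = path_reverse ` a"

lemma trace_reverse_class:
  assumes X: "is_dispace X" and f: "f \<in> dipaths X x y"
  shows "trace_reverse (trace_class X f) = trace_class (opp_dispace X) (path_reverse f)"
proof -
  \<comment> \<open>Stated for arbitrary \<open>Z\<close> so that it serves both \<open>X\<close>
    and its opposite. Since reversal is an involution, the inclusion for the opposite dispace yields
    the converse inclusion for \<open>X\<close>.\<close>
  have sub: "trace_reverse (trace_class Z p) \<subseteq> trace_class (opp_dispace Z) (path_reverse p)"
    if "p \<in> dipaths Z u v" for Z p and u v :: 'a
  proof -
    have "path_reverse q \<in> trace_class (opp_dispace Z) (path_reverse p)" if "q \<in> trace_class Z p" for q
      using trace_class_lift[OF that \<open>p \<in> dipaths Z u v\<close>,
          where F = "\<lambda>q. trace_class (opp_dispace Z) (path_reverse q)"]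
      by (auto simp: mem_trace_class trace_class_eq dest: reparam_step_reverse)
    then show ?thesis by (auto simp: trace_reverse_def)
  qed
  have rr: "path_reverse (path_reverse g) = g" if "g \<in> dipaths Z u v" "is_dispace Z" for g Z and u v :: 'a
    using that dpaths_extensional by (intro path_reverse_involutive) (auto simp: dipaths_def)
  note f' = path_reverse_dipaths[OF f]
  show ?thesis
  proof
    show "trace_class (opp_dispace X) (path_reverse f) \<subseteq> trace_reverse (trace_class X f)"
    proof
      fix g assume g: "g \<in> trace_class (opp_dispace X) (path_reverse f)"
      then have "path_reverse g \<in> trace_class X f"
        using sub[OF f'] by (auto simp: trace_reverse_def opp_opp_dispace[OF X] rr[OF f X])
      moreover have "path_reverse (path_reverse g) = g"
        using rr[OF trace_class_dipaths[OF f' g] is_dispace_opp[OF X]] .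
      ultimately show "g \<in> trace_reverse (trace_class X f)"
        unfolding trace_reverse_def by (metis imageI)
    qed
  qed (rule sub[OF f])
qed

lemma trace_reverse_in:
  assumes "is_dispace X" "a \<in> traces X x y"
  shows "trace_reverse a \<in> traces (opp_dispace X) y x"
  using assms by (auto simp: trace_reverse_class traces_def path_reverse_dipaths elim!: traces_cases)

lemma trace_reverse_involutive:
  assumes X: "is_dispace X" and a: "a \<in> traces X x y"
  shows "trace_reverse (trace_reverse a) = a"
proof -
  obtain f where f: "f \<in> dipaths X x y" and af: "a = trace_class X f"
    using a by (rule traces_cases)
  have "path_reverse (path_reverse f) = f"
    using f dpaths_extensional[OF X] by (intro path_reverse_involutive) (auto simp: dipaths_def)
  then show ?thesis
    by (simp add: af trace_reverse_class[OF X f] opp_opp_dispace[OF X]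
        trace_reverse_class[OF is_dispace_opp[OF X] path_reverse_dipaths[OF f]])
qed

lemma trace_reverse_id:
  assumes X: "is_dispace X" and x: "x \<in> topspace (dtop X)"
  shows "trace_reverse (trace_id X x) = trace_id (opp_dispace X) x"
proof -
  have "path_reverse (const_path x) = const_path x"
    by (auto simp: const_path_def path_reverse_def)
  then show ?thesis
    by (simp add: trace_id_def trace_reverse_class[OF X const_path_dipaths[OF X x]])
qed

lemma trace_reverse_concat:
  assumes X: "is_dispace X" and a: "a \<in> traces X x y" and b: "b \<in> traces X y z"
  shows "trace_reverse (trace_concat X a b) =
    trace_concat (opp_dispace X) (trace_reverse b) (trace_reverse a)"
proof -
  obtain f g where fg: "f \<in> dipaths X x y" "g \<in> dipaths X y z"
    and ab: "a = trace_class X f" "b = trace_class X g"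
    using a b by (auto elim!: traces_cases)
  have "path_reverse (path_concat f g) = path_concat (path_reverse g) (path_reverse f)"
    using fg by (intro path_reverse_concat) (auto simp: dipaths_def)
  then show ?thesis
    unfolding ab trace_concat_class[OF X fg] trace_reverse_class[OF X fg(1)]
      trace_reverse_class[OF X fg(2)] trace_reverse_class[OF X path_concat_dipaths[OF X fg]]
      trace_concat_class[OF is_dispace_opp[OF X] path_reverse_dipaths[OF fg(2)] path_reverse_dipaths[OF fg(1)]]
    by simp
qed

lemma dmaps_opp:
  assumes "\<phi> \<in> dmaps X Y" shows "\<phi> \<in> dmaps (opp_dispace X) (opp_dispace Y)"
proof -
  have "compose {0..1} \<phi> (path_reverse f) = path_reverse (compose {0..1} \<phi> f)" for f
    by (auto simp: compose_def path_reverse_def)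
  then show ?thesis using assms by (auto simp: dmaps_def)
qed

lemma trace_reverse_map:
  assumes X: "is_dispace X" and Y: "is_dispace Y" and \<phi>: "\<phi> \<in> dmaps X Y" and a: "a \<in> traces X x y"
  shows "trace_reverse (trace_map Y \<phi> a) = trace_map (opp_dispace Y) \<phi> (trace_reverse a)"
proof -
  obtain f where f: "f \<in> dipaths X x y" and af: "a = trace_class X f"
    using a by (rule traces_cases)
  have "compose {0..1} \<phi> (path_reverse f) = path_reverse (compose {0..1} \<phi> f)"
    by (auto simp: compose_def path_reverse_def)
  then show ?thesis
    unfolding af trace_map_class[OF Y \<phi> f] trace_reverse_class[OF X f]
      trace_reverse_class[OF Y dmaps_dipaths[OF \<phi> f]]
      trace_map_class[OF is_dispace_opp[OF Y] dmaps_opp[OF \<phi>] path_reverse_dipaths[OF f]] by simp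
qed


section \<open>The topology of trace spaces\<close>

lemma topspace_compact_open:
  "topspace (compact_open_topology A B) = {f \<in> extensional (topspace A). continuous_map A B f}"
proof -
  \<comment> \<open>The subbasic set given by the empty compact set and the empty open set is
    already the whole function space.\<close>
  have "f \<in> {f \<in> extensional (topspace A). continuous_map A B f \<and> f ` {} \<subseteq> {}}" "compactin A {}" "openin B {}"
    if "f \<in> extensional (topspace A)" "continuous_map A B f" for f
    using that by auto
  then show ?thesis
    unfolding compact_open_topology_def topology_generated_by_topspace by blast
qed

lemma openin_compact_open_basic:
  assumes "compactin A K" "openin B U"
  shows "openin (compact_open_topology A B) {f \<in> topspace (compact_open_topology A B). f ` K \<subseteq> U}"
proof -
  have "{f \<in> topspace (compact_open_topology A B). f ` K \<subseteq> U} =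
      {f \<in> extensional (topspace A). continuous_map A B f \<and> f ` K \<subseteq> U}"
    by (auto simp: topspace_compact_open)
  then show ?thesis
    unfolding compact_open_topology_def openin_topology_generated_by_iff
    using assms by (auto intro!: generate_topology_on.Basis)
qed

lemma continuous_map_into_compact_open:
  assumes maps: "\<And>u. u \<in> topspace Z \<Longrightarrow> F u \<in> topspace (compact_open_topology A B)"
    and basic: "\<And>K U. compactin A K \<Longrightarrow> openin B U \<Longrightarrow> openin Z {u \<in> topspace Z. F u ` K \<subseteq> U}"
  shows "continuous_map Z (compact_open_topology A B) F"
  unfolding compact_open_topology_def
proof (rule continuous_on_generated_topo)
  show "F ` topspace Z \<subseteq>
      \<Union> {{f \<in> extensional (topspace A). continuous_map A B f \<and> f ` K \<subseteq> U} |K U. compactin A K \<and> openin B U}"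
    using maps by (auto simp: compact_open_topology_def topology_generated_by_topspace[symmetric]
        simp del: topology_generated_by_topspace)
next
  fix W assume "W \<in> {{f \<in> extensional (topspace A). continuous_map A B f \<and> f ` K \<subseteq> U} |K U.
      compactin A K \<and> openin B U}"
  then obtain K U where KU: "compactin A K" "openin B U"
    and W: "W = {f \<in> extensional (topspace A). continuous_map A B f \<and> f ` K \<subseteq> U}" by blast
  have "F -` W \<inter> topspace Z = {u \<in> topspace Z. F u ` K \<subseteq> U}"
    using maps by (auto simp: W topspace_compact_open)
  then show "openin Z (F -` W \<inter> topspace Z)" using basic[OF KU] by simp
qed

lemma continuous_map_compact_open_precompose:
  assumes "continuous_map A' A \<theta>"
  shows "continuous_map (compact_open_topology A B) (compact_open_topology A' B)
    (\<lambda>f. compose (topspace A') f \<theta>)"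
proof (rule continuous_map_into_compact_open)
  fix f assume "f \<in> topspace (compact_open_topology A B)"
  then have "continuous_map A' B (f \<circ> \<theta>)"
    using assms by (auto simp: topspace_compact_open intro: continuous_map_compose)
  then have "continuous_map A' B (compose (topspace A') f \<theta>)"
    by (rule continuous_map_eq) (simp add: compose_def)
  then show "compose (topspace A') f \<theta> \<in> topspace (compact_open_topology A' B)"
    by (simp add: topspace_compact_open)
next
  fix K U assume K: "compactin A' K" and U: "openin B U"
  have "compactin A (\<theta> ` K)" using K assms by (rule image_compactin)
  then have "openin (compact_open_topology A B) {f \<in> topspace (compact_open_topology A B). f ` \<theta> ` K \<subseteq> U}"
    using U by (rule openin_compact_open_basic)
  moreover have "compose (topspace A') f \<theta> ` K \<subseteq> U \<longleftrightarrow> f ` \<theta> ` K \<subseteq> U" for f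
    using compactin_subset_topspace[OF K] by (auto simp: compose_def)
  ultimately show "openin (compact_open_topology A B)
      {f \<in> topspace (compact_open_topology A B). compose (topspace A') f \<theta> ` K \<subseteq> U}" by (simp only:)
qed

lemma continuous_map_compact_open_postcompose:
  assumes \<phi>: "continuous_map B B' \<phi>"
  shows "continuous_map (compact_open_topology A B) (compact_open_topology A B')
    (\<lambda>f. compose (topspace A) \<phi> f)"
proof (rule continuous_map_into_compact_open)
  fix f assume "f \<in> topspace (compact_open_topology A B)"
  then have "continuous_map A B' (\<phi> \<circ> f)"
    using assms by (auto simp: topspace_compact_open intro: continuous_map_compose)
  then have "continuous_map A B' (compose (topspace A) \<phi> f)"
    by (rule continuous_map_eq) (simp add: compose_def)
  then show "compose (topspace A) \<phi> f \<in> topspace (compact_open_topology A B')"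
    by (simp add: topspace_compact_open)
next
  fix K U assume K: "compactin A K" and U: "openin B' U"
  have "openin B {x \<in> topspace B. \<phi> x \<in> U}"
    using \<phi> U by (rule openin_continuous_map_preimage)
  with K have "openin (compact_open_topology A B)
      {f \<in> topspace (compact_open_topology A B). f ` K \<subseteq> {x \<in> topspace B. \<phi> x \<in> U}}"
    by (rule openin_compact_open_basic)
  moreover have "compose (topspace A) \<phi> f ` K \<subseteq> U \<longleftrightarrow> f ` K \<subseteq> {x \<in> topspace B. \<phi> x \<in> U}"
    if "f \<in> topspace (compact_open_topology A B)" for f
    using compactin_subset_topspace[OF K] that
    by (fastforce simp: compose_def topspace_compact_open continuous_map_def)
  then have "{f \<in> topspace (compact_open_topology A B). f ` K \<subseteq> {x \<in> topspace B. \<phi> x \<in> U}} =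
      {f \<in> topspace (compact_open_topology A B). compose (topspace A) \<phi> f ` K \<subseteq> U}" by blast
  ultimately show "openin (compact_open_topology A B)
      {f \<in> topspace (compact_open_topology A B). compose (topspace A) \<phi> f ` K \<subseteq> U}" by simp
qed

text \<open>The target carries no metric, but for a fixed \<open>g\<close> closeness can be measured
  in the parameter: the image of \<open>K\<close> under \<open>\<theta>\<close> is compact inside
  the open preimage of \<open>U\<close> under \<open>g\<close>, so a uniform neighbourhood of it
  fits there too. Intersections take the smaller radius, unions the radius of a member containing
  the path.\<close>

lemma compact_open_near_reparam:
  fixes B :: "'a topology" and \<theta> :: "real \<Rightarrow> real"
  defines "I \<equiv> top_of_set {0..1::real}"
  assumes W: "openin (compact_open_topology I B) W"
    and g: "continuous_map I B g" and \<theta>: "continuous_map I I \<theta>" and "compose {0..1} g \<theta> \<in> W"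
  shows "\<exists>\<epsilon>>0. \<forall>\<theta>'. continuous_map I I \<theta>' \<longrightarrow> (\<forall>t\<in>{0..1}. \<bar>\<theta>' t - \<theta> t\<bar> \<le> \<epsilon>) \<longrightarrow>
    compose {0..1} g \<theta>' \<in> W"
  using openin_topology_generated_by[OF W[unfolded compact_open_topology_def]] \<open>compose {0..1} g \<theta> \<in> W\<close>
proof (induction rule: generate_topology_on.induct)
  case (Int a b)
  then obtain d e where "d > 0" "e > 0"
    and "\<forall>\<theta>'. continuous_map I I \<theta>' \<longrightarrow> (\<forall>t\<in>{0..1}. \<bar>\<theta>' t - \<theta> t\<bar> \<le> d) \<longrightarrow> compose {0..1} g \<theta>' \<in> a"
    and "\<forall>\<theta>'. continuous_map I I \<theta>' \<longrightarrow> (\<forall>t\<in>{0..1}. \<bar>\<theta>' t - \<theta> t\<bar> \<le> e) \<longrightarrow> compose {0..1} g \<theta>' \<in> b"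
    by auto
  then show ?case by (intro exI[of _ "min d e"]) simp
next
  case (UN \<K>)
  then obtain k where k: "k \<in> \<K>" "compose {0..1} g \<theta> \<in> k" by blast
  from UN.IH[OF this] obtain \<epsilon> where "\<epsilon> > 0"
    and "\<forall>\<theta>'. continuous_map I I \<theta>' \<longrightarrow> (\<forall>t\<in>{0..1}. \<bar>\<theta>' t - \<theta> t\<bar> \<le> \<epsilon>) \<longrightarrow> compose {0..1} g \<theta>' \<in> k"
    by blast
  with k(1) show ?case by (intro exI[of _ \<epsilon>]) blast
next
  case (Basis s)
  then obtain K U where K: "compactin I K" and U: "openin B U"
    and s: "s = {f \<in> extensional (topspace I). continuous_map I B f \<and> f ` K \<subseteq> U}" by blast
  have K01: "K \<subseteq> {0..1}" using compactin_subset_topspace[OF K] by (simp add: I_def)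
  have "openin I {t \<in> topspace I. g t \<in> U}"
    using g U by (rule openin_continuous_map_preimage)
  then obtain V where V: "open V" "{t \<in> {0..1}. g t \<in> U} = {0..1} \<inter> V"
    by (auto simp: I_def openin_open)
  have "compact (\<theta> ` K)"
    using image_compactin[OF K \<theta>] by (simp add: I_def compactin_subtopology)
  moreover have \<theta>01: "\<theta> t \<in> {0..1}" if "t \<in> {0..1}" for t
    using \<theta> that by (auto simp: I_def continuous_map_def)
  have "\<theta> ` K \<subseteq> V"
  proof
    fix v assume "v \<in> \<theta> ` K"
    then obtain t where t: "t \<in> K" "v = \<theta> t" by blast
    then have "g v = compose {0..1} g \<theta> t" using K01 by (auto simp: compose_def)
    also have "\<dots> \<in> U" using Basis.prems t by (auto simp: s)
    finally have "g v \<in> U" .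
    then show "v \<in> V" using V(2) \<theta>01 t K01 by blast
  qed
  \<comment> \<open>The balls are taken in the real line and may leave the unit interval.
    \<open>V\<close> matches the preimage of \<open>U\<close> only inside it, so
    \<open>\<theta>' t \<in> {0..1}\<close> is used as well.\<close>
  ultimately obtain \<epsilon> where \<epsilon>: "\<epsilon> > 0" "(\<Union>v\<in>\<theta> ` K. cball v \<epsilon>) \<subseteq> V"
    using V(1) compact_subset_open_imp_cball_epsilon_subset by blast
  have "compose {0..1} g \<theta>' \<in> s"
    if \<theta>': "continuous_map I I \<theta>'" and near: "\<forall>t\<in>{0..1}. \<bar>\<theta>' t - \<theta> t\<bar> \<le> \<epsilon>" for \<theta>'
  proof -
    have "continuous_map I B (compose {0..1} g \<theta>')"
      by (rule continuous_map_eq[OF continuous_map_compose[OF \<theta>' g]]) (simp add: I_def compose_def)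
    moreover have "g (\<theta>' t) \<in> U" if t: "t \<in> K" for t
    proof -
      have "\<theta>' t \<in> cball (\<theta> t) \<epsilon>"
        using near t K01 by (auto simp: dist_real_def abs_minus_commute)
      then have "\<theta>' t \<in> V" using \<epsilon> t by blast
      moreover have "\<theta>' t \<in> {0..1}"
        using \<theta>' t K01 by (auto simp: I_def continuous_map_def)
      ultimately show ?thesis using V(2) by blast
    qed
    ultimately show ?thesis using K01 by (auto simp: s I_def compose_def)
  qed
  with \<epsilon>(1) show ?case by blast
qed auto

section \<open>Dipath spaces, trace spaces and the projection between them\<close>

lemma dipath_in_compact_open:
  assumes "is_dispace X" "f \<in> dpaths X"
  shows "f \<in> topspace (compact_open_topology (top_of_set {0..1}) (dtop X))"
  using dpaths_pathin[OF assms] dpaths_extensional[OF assms] by (simp add: topspace_compact_open pathin_def)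

lemma topspace_dipath_space:
  "is_dispace X \<Longrightarrow> topspace (dipath_space X x y) = dipaths X x y"
  using dipath_in_compact_open by (fastforce simp: dipath_space_def dipaths_def)

lemma topspace_trace_space:
  assumes "is_dispace X" shows "topspace (trace_space X x y) = traces X x y"
proof -
  have "openin (trace_space X x y) (trace_class X ` topspace (dipath_space X x y))"
    unfolding trace_space_def openin_quotient_topology
    by (metis (mono_tags, lifting) Collect_cong Collect_mem_eq image_eqI openin_topspace subset_refl)
  moreover have "U \<subseteq> trace_class X ` topspace (dipath_space X x y)" if "openin (trace_space X x y) U" for U
    using that by (simp add: trace_space_def openin_quotient_topology)
  ultimately show ?thesis
    unfolding traces_def topspace_dipath_space[OF assms, symmetric]
    by (meson antisym openin_subset openin_topspace)
qed

lemma surj_reparam_continuous_map: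
  "surj_reparam \<phi> \<Longrightarrow> continuous_map (top_of_set {0..1}) (top_of_set {0..1}) \<phi>"
  using surj_reparam_continuous surj_reparam_in by (force simp: surj_reparam_def)

lemma continuous_map_compose_reparam:
  assumes X: "is_dispace X" and \<theta>: "surj_reparam \<theta>"
  shows "continuous_map (dipath_space X x y) (dipath_space X x y) (\<lambda>f. compose {0..1} f \<theta>)"
  using continuous_map_compact_open_precompose[OF surj_reparam_continuous_map[OF \<theta>], of "dtop X"]
    compose_surj_reparam_in_dipaths[OF X _ \<theta>]
  by (auto simp: dipath_space_def continuous_map_in_subtopology intro: continuous_map_from_subtopology)

text \<open>The saturation of an open set \<open>W\<close> of dipaths is the union over \<open>\<theta>\<close> of the open sets
  \<open>{g. g \<circ> \<theta> \<in> W}\<close>.  That this union is closed under \<open>g \<mapsto> g \<circ> \<phi>\<close> uses an approximate section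
  \<open>s\<close> of \<open>\<phi>\<close>: the path \<open>g \<circ> \<phi> \<circ> s \<circ> \<theta>\<close> is still in \<open>W\<close> because it is close to \<open>g \<circ> \<theta>\<close>.\<close>

lemma open_map_trace_class:
  assumes X: "is_dispace X"
  shows "open_map (dipath_space X x y) (trace_space X x y) (trace_class X)"
  unfolding open_map_def
proof (intro allI impI)
  fix W assume W: "openin (dipath_space X x y) W"
  let ?O = "\<Union>\<theta>\<in>Collect surj_reparam. {g \<in> topspace (dipath_space X x y). compose {0..1} g \<theta> \<in> W}"
  have WX: "W \<subseteq> dipaths X x y" using openin_subset[OF W] by (simp add: topspace_dipath_space[OF X])
  obtain W' where W': "openin (compact_open_topology (top_of_set {0..1}) (dtop X)) W'"
    and WW': "W = W' \<inter> dipaths X x y"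
    using W by (auto simp: dipath_space_def openin_subtopology)
  have ext: "p \<in> extensional {0..1}" if "p \<in> dipaths X x y" for p
    using that dpaths_extensional[OF X] by (auto simp: dipaths_def)
  \<comment> \<open>This direction is exact: \<open>q \<circ> \<theta>\<close> equals
    \<open>p \<circ> \<phi> \<circ> \<theta>\<close> on the interval, so \<open>p\<close> lies in
    the member of the union indexed by \<open>\<phi> \<circ> \<theta>\<close>.\<close>
  have down: "p \<in> ?O" if pq: "reparam_step X p q" "q \<in> ?O" for p q
  proof -
    obtain \<theta> where \<theta>: "surj_reparam \<theta>" "compose {0..1} q \<theta> \<in> W" using pq(2) by blast
    obtain \<phi> where \<phi>: "surj_reparam \<phi>" "q = compose {0..1} p \<phi>"
      using pq(1) by (auto simp: reparam_step_iff)
    have "compose {0..1} q \<theta> = compose {0..1} p (\<lambda>t. \<phi> (\<theta> t))"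
      using surj_reparam_in[OF \<theta>(1)] by (auto simp: \<phi>(2) compose_def fun_eq_iff)
    moreover have "p \<in> dipaths X x y"
      using pq by (auto simp: topspace_dipath_space[OF X] reparam_step_dipaths)
    ultimately show ?thesis
      using \<theta> \<phi> surj_reparam_comp by (auto simp: topspace_dipath_space[OF X])
  qed
  have up: "q \<in> ?O" if pq: "reparam_step X p q" "p \<in> ?O" for p q
  proof -
    obtain \<theta> where \<theta>: "surj_reparam \<theta>" "compose {0..1} p \<theta> \<in> W" using pq(2) by blast
    obtain \<phi> where \<phi>: "surj_reparam \<phi>" "q = compose {0..1} p \<phi>"
      using pq(1) by (auto simp: reparam_step_iff)
    have p: "p \<in> dipaths X x y" using pq(2) by (auto simp: topspace_dipath_space[OF X])
    then have q: "q \<in> dipaths X x y" using pq(1) by (simp add: reparam_step_dipaths)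
    have "continuous_map (top_of_set {0..1}) (dtop X) p"
      using p dpaths_pathin[OF X] by (simp add: dipaths_def pathin_def)
    then obtain \<epsilon> where "\<epsilon> > 0" and \<epsilon>: "\<And>\<theta>'. continuous_map (top_of_set {0..1}) (top_of_set {0..1}) \<theta>' \<Longrightarrow>
        (\<forall>t\<in>{0..1}. \<bar>\<theta>' t - \<theta> t\<bar> \<le> \<epsilon>) \<Longrightarrow> compose {0..1} p \<theta>' \<in> W'"
      using compact_open_near_reparam[OF W' _ surj_reparam_continuous_map[OF \<theta>(1)]] \<theta>(2) WW' by blast
    obtain s where s: "surj_reparam s" "\<And>u. u \<in> {0..1} \<Longrightarrow> \<bar>\<phi> (s u) - u\<bar> \<le> \<epsilon>"
      using surj_reparam_approx_section[OF \<phi>(1) \<open>\<epsilon> > 0\<close>] by blast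
    have s\<theta>: "surj_reparam (\<lambda>t. s (\<theta> t))" and \<phi>s\<theta>: "surj_reparam (\<lambda>t. \<phi> (s (\<theta> t)))"
      using surj_reparam_comp[OF s(1) \<theta>(1)] surj_reparam_comp[OF \<phi>(1)] by blast+
    have "compose {0..1} p (\<lambda>t. \<phi> (s (\<theta> t))) \<in> W'"
      using s(2) surj_reparam_in[OF \<theta>(1)] by (intro \<epsilon> surj_reparam_continuous_map[OF \<phi>s\<theta>]) blast
    moreover have "compose {0..1} q (\<lambda>t. s (\<theta> t)) = compose {0..1} p (\<lambda>t. \<phi> (s (\<theta> t)))"
      using surj_reparam_in[OF s\<theta>] by (auto simp: \<phi>(2) compose_def fun_eq_iff)
    ultimately have "compose {0..1} q (\<lambda>t. s (\<theta> t)) \<in> W"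
      using compose_surj_reparam_in_dipaths[OF X p \<phi>s\<theta>] by (simp add: WW')
    then show ?thesis using s\<theta> q by (auto simp: topspace_dipath_space[OF X])
  qed
  have "W \<subseteq> ?O"
  proof
    fix p assume "p \<in> W"
    then show "p \<in> ?O"
      using surj_reparam_id WX compose_id_path[OF ext] by (force simp: topspace_dipath_space[OF X])
  qed
  have "{p \<in> topspace (dipath_space X x y). trace_class X p \<in> trace_class X ` W} = ?O"
  proof (intro equalityI subsetI)
    fix p assume "p \<in> {p \<in> topspace (dipath_space X x y). trace_class X p \<in> trace_class X ` W}"
    then obtain q where "q \<in> W" "trace_class X q = trace_class X p" by auto
    then have "q \<in> W" "equivclp (reparam_step X) q p" by (simp_all add: trace_class_eq)
    \<comment> \<open>Each link of the zigzag from \<open>q\<close> to \<open>p\<close> is a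
      reparametrization step in one of the two directions, so \<open>up\<close> and
      \<open>down\<close> propagate membership in the union from \<open>q\<close> to
      \<open>p\<close>.\<close>
    from this(2) show "p \<in> ?O"
      proof (induction rule: equivclp_induct)
      case base
      then show ?case using \<open>q \<in> W\<close> \<open>W \<subseteq> ?O\<close> by (rule subsetD[rotated])
    next
      case (step r p)
      then show ?case using up[of r p] down[of p r] by (elim disjE) simp_all
    qed
  next
    fix p assume "p \<in> ?O"
    then obtain \<theta> where \<theta>: "surj_reparam \<theta>" "p \<in> dipaths X x y" "compose {0..1} p \<theta> \<in> W"
      by (auto simp: topspace_dipath_space[OF X])
    then have "trace_class X p = trace_class X (compose {0..1} p \<theta>)"
      by (simp add: dipaths_def trace_class_compose[OF X])
    then show "p \<in> {p \<in> topspace (dipath_space X x y). trace_class X p \<in> trace_class X ` W}"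
      using \<theta> by (auto simp: topspace_dipath_space[OF X])
  qed
  moreover have "openin (dipath_space X x y) ?O"
    using openin_continuous_map_preimage[OF continuous_map_compose_reparam[OF X] W] by blast
  ultimately show "openin (trace_space X x y) (trace_class X ` W)"
    using WX by (auto simp: trace_space_def openin_quotient_topology topspace_dipath_space[OF X])
qed

lemma quotient_map_trace_class:
  assumes X: "is_dispace X"
  shows "quotient_map (dipath_space X x y) (trace_space X x y) (trace_class X)"
  unfolding quotient_map_def topspace_trace_space[OF X] topspace_dipath_space[OF X]
  by (auto simp: traces_def trace_space_def openin_quotient_topology topspace_dipath_space[OF X])

section \<open>Continuity of concatenation, induced maps and reversal on traces\<close>

lemma open_map_prod:
  assumes f: "open_map X X' f" and g: "open_map Y Y' g"
  shows "open_map (prod_topology X Y) (prod_topology X' Y') (\<lambda>(x, y). (f x, g y))"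
  unfolding open_map_def
proof (intro allI impI)
  fix W assume W: "openin (prod_topology X Y) W"
  show "openin (prod_topology X' Y') ((\<lambda>(x, y). (f x, g y)) ` W)"
    unfolding openin_prod_topology_alt
  proof (intro allI impI)
    fix a b assume "(a, b) \<in> (\<lambda>(x, y). (f x, g y)) ` W"
    then obtain x y where xy: "(x, y) \<in> W" "a = f x" "b = g y" by auto
    then obtain U V where UV: "openin X U" "openin Y V" "x \<in> U" "y \<in> V" "U \<times> V \<subseteq> W"
      using W unfolding openin_prod_topology_alt by meson
    then have "openin X' (f ` U)" "openin Y' (g ` V)" "a \<in> f ` U" "b \<in> g ` V"
        "f ` U \<times> g ` V \<subseteq> (\<lambda>(x, y). (f x, g y)) ` W"
      using f g xy by (auto simp: open_map_def)
    then show "\<exists>U V. openin X' U \<and> openin Y' V \<and> a \<in> U \<and> b \<in> V \<and> U \<times> V \<subseteq> (\<lambda>(x, y). (f x, g y)) ` W"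
      by blast
  qed
qed

text \<open>A product of quotient maps need not be a quotient map; here it is one because both factors are open.\<close>

lemma quotient_map_trace_class_prod:
  assumes X: "is_dispace X"
  shows "quotient_map (prod_topology (dipath_space X x y) (dipath_space X y z))
    (prod_topology (trace_space X x y) (trace_space X y z)) (\<lambda>(f, g). (trace_class X f, trace_class X g))"
proof (rule continuous_open_imp_quotient_map)
  show "continuous_map (prod_topology (dipath_space X x y) (dipath_space X y z))
      (prod_topology (trace_space X x y) (trace_space X y z)) (\<lambda>(f, g). (trace_class X f, trace_class X g))"
    using quotient_imp_continuous_map[OF quotient_map_trace_class[OF X]]
    by (simp add: continuous_map_prod_top)
  show "(\<lambda>(f, g). (trace_class X f, trace_class X g)) ` topspace (prod_topology (dipath_space X x y) (dipath_space X y z)) =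
      topspace (prod_topology (trace_space X x y) (trace_space X y z))"
    by (auto simp: topspace_dipath_space[OF X] topspace_trace_space[OF X] traces_def)
qed (intro open_map_prod open_map_trace_class X)

text \<open>The compact set is cut at \<open>1/2\<close> and each piece is rescaled to the
  parameters of its factor. The preimage of a subbasic set is then a product of two subbasic sets
  restricted to dipaths, hence open.\<close>

lemma continuous_map_path_concat:
  assumes X: "is_dispace X"
  shows "continuous_map (prod_topology (dipath_space X x y) (dipath_space X y z)) (dipath_space X x z)
    (\<lambda>(f, g). path_concat f g)"
proof -
  let ?I = "top_of_set {0..1::real}"
  let ?Z = "prod_topology (dipath_space X x y) (dipath_space X y z)"
  have "continuous_map ?Z (compact_open_topology ?I (dtop X)) (\<lambda>(f, g). path_concat f g)"
  proof (rule continuous_map_into_compact_open)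
    fix u assume "u \<in> topspace ?Z"
    then obtain f g where "u = (f, g)" "f \<in> dipaths X x y" "g \<in> dipaths X y z"
      by (auto simp: topspace_dipath_space[OF X])
    moreover from this have "path_concat f g \<in> dpaths X"
      using path_concat_dipaths[OF X] by (auto simp: dipaths_def)
    ultimately show "(case u of (f, g) \<Rightarrow> path_concat f g) \<in> topspace (compact_open_topology ?I (dtop X))"
      by (simp add: dipath_in_compact_open[OF X])
  next
    fix K U assume K: "compactin ?I K" and U: "openin (dtop X) U"
    then have "compact K" and K01: "K \<subseteq> {0..1}" by (auto simp: compactin_subtopology)
    let ?K1 = "(\<lambda>t. 2 * t) ` (K \<inter> {0..1/2})" and ?K2 = "(\<lambda>t. 2 * t - 1) ` (K \<inter> {1/2..1})"
    let ?U1 = "{f \<in> topspace (dipath_space X x y). f ` ?K1 \<subseteq> U}"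
    let ?U2 = "{g \<in> topspace (dipath_space X y z). g ` ?K2 \<subseteq> U}"
    have "compactin ?I ?K1" "compactin ?I ?K2"
      using \<open>compact K\<close> by (auto simp: compactin_subtopology intro!: compact_continuous_image continuous_intros)
    then have "openin (compact_open_topology ?I (dtop X)) {f \<in> topspace (compact_open_topology ?I (dtop X)). f ` ?K1 \<subseteq> U}"
      "openin (compact_open_topology ?I (dtop X)) {f \<in> topspace (compact_open_topology ?I (dtop X)). f ` ?K2 \<subseteq> U}"
      using U by (intro openin_compact_open_basic; simp)+
    moreover have "?U1 = {f \<in> topspace (compact_open_topology ?I (dtop X)). f ` ?K1 \<subseteq> U} \<inter> dipaths X x y"
      "?U2 = {f \<in> topspace (compact_open_topology ?I (dtop X)). f ` ?K2 \<subseteq> U} \<inter> dipaths X y z"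
      by (auto simp: dipath_space_def)
    ultimately have "openin (dipath_space X x y) ?U1" "openin (dipath_space X y z) ?U2"
      unfolding dipath_space_def openin_subtopology by blast+
    then have "openin ?Z (?U1 \<times> ?U2)" by (simp add: openin_prod_Times_iff)
    moreover have concat_iff: "path_concat f g ` K \<subseteq> U \<longleftrightarrow> f ` ?K1 \<subseteq> U \<and> g ` ?K2 \<subseteq> U"
      if "f \<in> dipaths X x y" "g \<in> dipaths X y z" for f g
    proof -
      have "path_concat f g t = g (2 * t - 1)" if "t \<in> {1/2..1}" for t
      \<comment> \<open>The parameter \<open>1/2\<close> is assigned to both pieces; concatenation
        reads \<open>f 1\<close> there, which is \<open>g 0\<close> because both equal
        \<open>y\<close>.\<close>
      proof (cases "t = 1/2")
        case True
        have "path_concat f g t = f 1" "2 * t - 1 = 0" unfolding True by (simp_all add: path_concat_def)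
        then show ?thesis
          using \<open>f \<in> dipaths X x y\<close> \<open>g \<in> dipaths X y z\<close> by (simp add: dipaths_def)
      qed (use that in \<open>auto simp: path_concat_def\<close>)
      moreover have "path_concat f g t = f (2 * t)" if "t \<in> {0..1/2}" for t
        using that by (simp add: path_concat_def)
      ultimately have "f ` ?K1 = path_concat f g ` (K \<inter> {0..1/2})" "g ` ?K2 = path_concat f g ` (K \<inter> {1/2..1})"
        by (force simp: image_image)+
      moreover have "K = (K \<inter> {0..1/2}) \<union> (K \<inter> {1/2..1})" using K01 by auto
      ultimately show ?thesis by (metis image_Un le_sup_iff)
    qed
    have "u \<in> {u \<in> topspace ?Z. (case u of (f, g) \<Rightarrow> path_concat f g) ` K \<subseteq> U} \<longleftrightarrow> u \<in> ?U1 \<times> ?U2" for u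
      unfolding mem_Collect_eq topspace_prod_topology topspace_dipath_space[OF X]
      by (cases u) (simp only: mem_Sigma_iff mem_Collect_eq case_prod_conv, metis concat_iff)
    then have "{u \<in> topspace ?Z. (case u of (f, g) \<Rightarrow> path_concat f g) ` K \<subseteq> U} = ?U1 \<times> ?U2"
      by (rule set_eqI)
    ultimately show "openin ?Z {u \<in> topspace ?Z. (case u of (f, g) \<Rightarrow> path_concat f g) ` K \<subseteq> U}"
      by simp
  qed
  moreover have "(case u of (f, g) \<Rightarrow> path_concat f g) \<in> dipaths X x z" if "u \<in> topspace ?Z" for u
    using that path_concat_dipaths[OF X] by (auto simp: topspace_dipath_space[OF X])
  ultimately show ?thesis
    unfolding dipath_space_def[of X x z] by (auto simp: continuous_map_in_subtopology)
qed

lemma continuous_map_trace_concat: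
  assumes X: "is_dispace X"
  shows "continuous_map (prod_topology (trace_space X x y) (trace_space X y z)) (trace_space X x z)
    (\<lambda>(a, b). trace_concat X a b)"
proof (rule continuous_compose_quotient_map[OF quotient_map_trace_class_prod[OF X]])
  have "continuous_map (prod_topology (dipath_space X x y) (dipath_space X y z)) (trace_space X x z)
      (trace_class X \<circ> (\<lambda>(f, g). path_concat f g))"
    using continuous_map_path_concat[OF X] quotient_imp_continuous_map[OF quotient_map_trace_class[OF X]]
    by (rule continuous_map_compose)
  then show "continuous_map (prod_topology (dipath_space X x y) (dipath_space X y z)) (trace_space X x z)
      ((\<lambda>(a, b). trace_concat X a b) \<circ> (\<lambda>(f, g). (trace_class X f, trace_class X g)))"
    by (rule continuous_map_eq) (auto simp: topspace_dipath_space[OF X] trace_concat_class[OF X])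
qed

lemma continuous_map_trace_map:
  assumes X: "is_dispace X" and Y: "is_dispace Y" and \<phi>: "\<phi> \<in> dmaps X Y"
  shows "continuous_map (trace_space X x y) (trace_space Y (\<phi> x) (\<phi> y)) (trace_map Y \<phi>)"
proof (rule continuous_compose_quotient_map[OF quotient_map_trace_class[OF X]])
  have "continuous_map (dipath_space X x y) (dipath_space Y (\<phi> x) (\<phi> y)) (\<lambda>f. compose {0..1} \<phi> f)"
    using continuous_map_compact_open_postcompose[of "dtop X" "dtop Y" \<phi> "top_of_set {0..1::real}"]
      \<phi> dmaps_dipaths[OF \<phi>]
    by (auto simp: dipath_space_def dmaps_def continuous_map_in_subtopology intro: continuous_map_from_subtopology)
  then have "continuous_map (dipath_space X x y) (trace_space Y (\<phi> x) (\<phi> y))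
      (trace_class Y \<circ> (\<lambda>f. compose {0..1} \<phi> f))"
    using quotient_imp_continuous_map[OF quotient_map_trace_class[OF Y]] by (rule continuous_map_compose)
  then show "continuous_map (dipath_space X x y) (trace_space Y (\<phi> x) (\<phi> y)) (trace_map Y \<phi> \<circ> trace_class X)"
    by (rule continuous_map_eq) (auto simp: topspace_dipath_space[OF X] trace_map_class[OF Y \<phi>])
qed

lemma continuous_map_trace_reverse:
  assumes X: "is_dispace X"
  shows "continuous_map (trace_space X x y) (trace_space (opp_dispace X) y x) trace_reverse"
proof (rule continuous_compose_quotient_map[OF quotient_map_trace_class[OF X]])
  have "continuous_map (top_of_set {0..1}) (top_of_set {0..1}) (\<lambda>t::real. 1 - t)"
    by (auto intro!: continuous_intros)
  from continuous_map_compact_open_precompose[OF this, of "dtop X"]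
  have "continuous_map (dipath_space X x y) (dipath_space (opp_dispace X) y x) path_reverse"
    using path_reverse_dipaths[of _ X x y]
    by (auto simp: path_reverse_eq_compose[abs_def] dipath_space_def continuous_map_in_subtopology
        intro: continuous_map_from_subtopology)
  then have "continuous_map (dipath_space X x y) (trace_space (opp_dispace X) y x)
      (trace_class (opp_dispace X) \<circ> path_reverse)"
    using quotient_imp_continuous_map[OF quotient_map_trace_class[OF is_dispace_opp[OF X]]]
    by (rule continuous_map_compose)
  then show "continuous_map (dipath_space X x y) (trace_space (opp_dispace X) y x)
      (trace_reverse \<circ> trace_class X)"
    by (rule continuous_map_eq) (auto simp: topspace_dipath_space[OF X] trace_reverse_class[OF X])
qed


section \<open>Elements of natural homotopy\<close>

text \<open>The empty product has exactly one point, the everywhere undefined function; this is the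
  argument at which representatives are evaluated below. Truncated subtraction makes
  \<open>n - 1\<close> equal to 0 both for \<open>n = 0\<close> and for
  \<open>n = 1\<close>.\<close>

lemma topspace_cube_0: "topspace (cube 0) = {\<lambda>_. undefined}"
  by (simp add: cube_def PiE_empty_domain)

text \<open>The 0-cube is a point, so cube maps also represent the elements for \<open>n = 0\<close> and \<open>n = 1\<close>.
  Through \<open>htpy_elem\<close>, every identity between elements of natural homotopy reduces to a pointwise
  identity between traces.\<close>

definition htpy_rep :: "nat \<Rightarrow> 'a trace topology \<Rightarrow> 'a trace \<Rightarrow> ((nat \<Rightarrow> real) \<Rightarrow> 'a trace) \<Rightarrow> bool" where
  "htpy_rep n T f s \<longleftrightarrow> s \<in> cube_maps (n - 1) T f \<and> (n = 0 \<longrightarrow> s (\<lambda>_. undefined) = f)"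

definition htpy_elem ::
  "nat \<Rightarrow> 'a trace topology \<Rightarrow> 'a trace \<Rightarrow> ((nat \<Rightarrow> real) \<Rightarrow> 'a trace) \<Rightarrow> 'a nat_htpy" where
  "htpy_elem n T f s =
    (if n = 0 then Point (s (\<lambda>_. undefined))
     else if n = 1 then Component (path_component_of_set T (s (\<lambda>_. undefined)))
     else Sphere (homotopy_class (n - 1) T f s))"

lemma cube_boundary_subset: "cube_boundary m \<subseteq> topspace (cube m)"
  by (auto simp: cube_boundary_def)

lemma htpy_rep_in_topspace:
  "htpy_rep n T f s \<Longrightarrow> u \<in> topspace (cube (n - 1)) \<Longrightarrow> s u \<in> topspace T"
  by (auto simp: htpy_rep_def cube_maps_def continuous_map_def)

lemma htpy_rep_const: "f \<in> topspace T \<Longrightarrow> htpy_rep n T f (\<lambda>_. f)"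
  by (simp add: htpy_rep_def cube_maps_def)

text \<open>The 0-cube has empty boundary, so the value of a representative is not tied to
  \<open>f\<close>: in degree 1 every path component of the trace space occurs over every
  trace.\<close>

lemma htpy_rep_component: "a \<in> topspace T \<Longrightarrow> htpy_rep (Suc 0) T f (\<lambda>_. a)"
  by (simp add: htpy_rep_def cube_maps_def cube_boundary_def)

lemma homotopy_class_eq:
  assumes "homotopic_with (\<lambda>h. \<forall>u \<in> cube_boundary m. h u = b) (cube m) T s t"
  shows "homotopy_class m T b s = homotopy_class m T b t"
  unfolding homotopy_class_def
  using homotopic_with_trans[OF assms] homotopic_with_trans[OF homotopic_with_symD[OF assms]] by blast

lemma homotopy_class_self: "s \<in> cube_maps m T b \<Longrightarrow> s \<in> homotopy_class m T b s"
  by (auto simp: homotopy_class_def cube_maps_def intro!: homotopic_with_equal)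

lemma UN2_constant_eq:
  assumes "a \<in> A" "b \<in> B" "\<And>x y. x \<in> A \<Longrightarrow> y \<in> B \<Longrightarrow> F x y = F a b"
  shows "(\<Union>x \<in> A. \<Union>y \<in> B. F x y) = F a b"
  using assms by blast

lemma path_component_of_set_eq:
  "path_component_of T a b \<Longrightarrow> path_component_of_set T a = path_component_of_set T b"
  by (simp add: path_component_of_equiv)

text \<open>Agreement on the cube is enough, since a homotopy ignores values elsewhere. This matters
  because representatives are guaranteed to take traces as values only on the cube, so the laws of
  traces are available only there.\<close>

lemma htpy_elem_cong:
  assumes s: "htpy_rep n T f s" and st: "\<And>u. u \<in> topspace (cube (n - 1)) \<Longrightarrow> s u = t u"
  shows "htpy_elem n T f s = htpy_elem n T f t"
proof -
  have "homotopic_with (\<lambda>h. \<forall>u \<in> cube_boundary (n - 1). h u = f) (cube (n - 1)) T s t"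
  proof (rule homotopic_with_equal)
    show s_bd: "\<forall>u \<in> cube_boundary (n - 1). s u = f"
      using s by (simp add: htpy_rep_def cube_maps_def)
    then show "\<forall>u \<in> cube_boundary (n - 1). t u = f"
      using st cube_boundary_subset by (metis subsetD)
  qed (use s st in \<open>simp_all add: htpy_rep_def cube_maps_def\<close>)
  then have "homotopy_class (n - 1) T f s = homotopy_class (n - 1) T f t"
    by (rule homotopy_class_eq)
  moreover have "n \<le> 1 \<Longrightarrow> s (\<lambda>_. undefined) = t (\<lambda>_. undefined)"
    using st[of "\<lambda>_. undefined"] by (simp add: topspace_cube_0)
  ultimately show ?thesis by (simp add: htpy_elem_def)
qed

text \<open>For \<open>n = 0\<close> the extra clause of \<open>htpy_rep\<close> pins the value to
  \<open>f\<close> and leaves one element; for \<open>n = 1\<close> a representative amounts to a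
  point of the trace space and names its component; for larger \<open>n\<close> the definitions
  coincide.\<close>

lemma nat_htpy_set_eq:
  assumes X: "is_dispace X" and f: "f \<in> traces X x y"
  shows "nat_htpy_set n X x y f =
    htpy_elem n (trace_space X x y) f ` Collect (htpy_rep n (trace_space X x y) f)"
proof -
  let ?T = "trace_space X x y"
  have fT: "f \<in> topspace ?T" by (simp add: topspace_trace_space[OF X] f)
  consider "n = 0" | "n = 1" | "n \<ge> 2" by linarith
  then show ?thesis
  proof cases
    case 1
    have "htpy_elem n ?T f s = Point f" if "htpy_rep n ?T f s" for s
      using that 1 by (simp add: htpy_elem_def htpy_rep_def)
    then have "htpy_elem n ?T f ` Collect (htpy_rep n ?T f) = {Point f}"
      using htpy_rep_const[OF fT, of n] by auto
    then show ?thesis using 1 by (simp add: nat_htpy_set_def)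
  next
    case 2
    have "Component ` path_components_of ?T = (\<lambda>a. htpy_elem n ?T f (\<lambda>_. a)) ` topspace ?T"
      using 2 by (simp add: path_components_of_def htpy_elem_def image_image)
    also have "\<dots> = htpy_elem n ?T f ` Collect (htpy_rep n ?T f)"
    proof (intro equalityI subsetI)
      fix \<sigma> assume "\<sigma> \<in> htpy_elem n ?T f ` Collect (htpy_rep n ?T f)"
      then obtain s where s: "htpy_rep n ?T f s" "\<sigma> = htpy_elem n ?T f s" by blast
      have "s (\<lambda>_. undefined) \<in> topspace ?T"
        using htpy_rep_in_topspace[OF s(1)] 2 by (simp add: topspace_cube_0)
      moreover have "\<sigma> = htpy_elem n ?T f (\<lambda>_. s (\<lambda>_. undefined))"
        using 2 by (simp add: s(2) htpy_elem_def)
      ultimately show "\<sigma> \<in> (\<lambda>a. htpy_elem n ?T f (\<lambda>_. a)) ` topspace ?T" by blast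
    next
      fix \<sigma> assume "\<sigma> \<in> (\<lambda>a. htpy_elem n ?T f (\<lambda>_. a)) ` topspace ?T"
      then show "\<sigma> \<in> htpy_elem n ?T f ` Collect (htpy_rep n ?T f)"
        using htpy_rep_component[of _ ?T f] 2 by auto
    qed
    finally show ?thesis using 2 by (simp add: nat_htpy_set_def)
  next
    case 3
    have "htpy_elem n ?T f s = Sphere (homotopy_class (n - 1) ?T f s)" for s
      using 3 by (simp add: htpy_elem_def)
    moreover have "Collect (htpy_rep n ?T f) = cube_maps (n - 1) ?T f"
      using 3 by (auto simp: htpy_rep_def)
    ultimately show ?thesis
      using 3 by (simp add: nat_htpy_set_def homotopy_group_def image_image)
  qed
qed

lemma nat_htpy_base_eq: "nat_htpy_base n X x y f = htpy_elem n (trace_space X x y) f (\<lambda>_. f)"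
  by (simp add: nat_htpy_base_def htpy_elem_def)

text \<open>The pattern of \<open>nat_htpy_map\<close> for an arbitrary map \<open>k\<close> between
  trace spaces. Taking \<open>trace_map Y \<phi>\<close> or \<open>trace_reverse\<close> for
  \<open>k\<close> yields the induced functors and the reversal functor from one well-definedness
  proof.\<close>

fun nat_htpy_pushforward ::
  "nat \<Rightarrow> 'a trace topology \<Rightarrow> ('a trace \<Rightarrow> 'a trace) \<Rightarrow> 'a trace \<Rightarrow> 'a nat_htpy \<Rightarrow> 'a nat_htpy" where
  "nat_htpy_pushforward n T k f (Point f') = Point (k f')"
| "nat_htpy_pushforward n T k f (Component A) = Component (\<Union>a \<in> A. path_component_of_set T (k a))"
| "nat_htpy_pushforward n T k f (Sphere \<sigma>) =
    Sphere (\<Union>s \<in> \<sigma>. homotopy_class (n - 1) T (k f) (\<lambda>u. k (s u)))"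

lemma nat_htpy_map_eq:
  "nat_htpy_map n Y \<phi> x y f \<sigma> = nat_htpy_pushforward n (trace_space Y (\<phi> x) (\<phi> y)) (trace_map Y \<phi>) f \<sigma>"
  by (cases \<sigma>) simp_all

lemma htpy_rep_pushforward:
  assumes s: "htpy_rep n T f s" and k: "continuous_map T T' k"
  shows "htpy_rep n T' (k f) (\<lambda>u. k (s u))"
  using s continuous_map_compose[OF _ k, of "cube (n - 1)" s]
  by (auto simp: htpy_rep_def cube_maps_def o_def)

text \<open>A continuous map carries paths to paths, and homotopies relative to the boundary to such
  homotopies. The unions over representatives therefore have a single value, attained at the chosen
  \<open>s\<close>.\<close>

lemma nat_htpy_pushforward_elem:
  assumes s: "htpy_rep n T f s" and k: "continuous_map T T' k"
  shows "nat_htpy_pushforward n T' k f (htpy_elem n T f s) = htpy_elem n T' (k f) (\<lambda>u. k (s u))"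
proof -
  consider "n = 0" | "n = 1" | "n \<ge> 2" by linarith
  then show ?thesis
  proof cases
    case 2
    let ?a = "s (\<lambda>_. undefined)"
    have "path_component_of T' (k ?a) (k a)" if "path_component_of T ?a a" for a
      using that pathin_compose[OF _ k] unfolding path_component_of_def by (metis comp_apply)
    then have "path_component_of_set T' (k a) = path_component_of_set T' (k ?a)" if "path_component_of T ?a a" for a
      using that path_component_of_set_eq by metis
    moreover have "path_component_of T ?a ?a"
      using htpy_rep_in_topspace[OF s] 2 by (simp add: topspace_cube_0 path_component_of_refl)
    ultimately have "(\<Union>a \<in> path_component_of_set T ?a. path_component_of_set T' (k a)) = path_component_of_set T' (k ?a)"
      by blast
    then show ?thesis using 2 by (simp add: htpy_elem_def)
  next
    case 3
    have "homotopy_class (n - 1) T' (k f) (\<lambda>u. k (t u)) = homotopy_class (n - 1) T' (k f) (\<lambda>u. k (s u))"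
      if "t \<in> homotopy_class (n - 1) T f s" for t
    proof -
      have "homotopic_with (\<lambda>h. \<forall>u \<in> cube_boundary (n - 1). h u = f) (cube (n - 1)) T s t"
        using that by (simp add: homotopy_class_def)
      then have "homotopic_with (\<lambda>h. \<forall>u \<in> cube_boundary (n - 1). h u = k f) (cube (n - 1)) T' (k \<circ> s) (k \<circ> t)"
        by (rule homotopic_with_compose_continuous_map_left[OF _ k]) simp
      then show ?thesis by (simp add: homotopy_class_eq o_def)
    qed
    moreover have "s \<in> homotopy_class (n - 1) T f s"
      using s by (simp add: homotopy_class_self htpy_rep_def)
    ultimately have "(\<Union>t \<in> homotopy_class (n - 1) T f s. homotopy_class (n - 1) T' (k f) (\<lambda>u. k (t u))) =
        homotopy_class (n - 1) T' (k f) (\<lambda>u. k (s u))"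
      by blast
    then show ?thesis using 3 by (simp add: htpy_elem_def)
  qed (simp add: htpy_elem_def)
qed

section \<open>Binary operations on homotopy classes\<close>

lemma continuous_map_binary:
  assumes "continuous_map (prod_topology T T') T'' (\<lambda>(a, b). K a b)"
    and "continuous_map Z T s" "continuous_map Z T' t"
  shows "continuous_map Z T'' (\<lambda>u. K (s u) (t u))"
  using continuous_map_compose[OF continuous_map_pairedI[OF assms(2,3)] assms(1)] by (simp add: o_def)

text \<open>Both homotopies run with the same time parameter and are combined by \<open>K\<close>.
  The argument rests on joint continuity of \<open>K\<close>, not just continuity in each
  variable.\<close>

lemma homotopic_with_binary:
  assumes K: "continuous_map (prod_topology T T') T'' (\<lambda>(a, b). K a b)"
    and "homotopic_with (\<lambda>h. \<forall>u \<in> D. h u = f) C T s s'"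
    and "homotopic_with (\<lambda>h. \<forall>u \<in> D. h u = g) C T' t t'"
  shows "homotopic_with (\<lambda>h. \<forall>u \<in> D. h u = K f g) C T'' (\<lambda>u. K (s u) (t u)) (\<lambda>u. K (s' u) (t' u))"
proof -
  let ?Z = "prod_topology (top_of_set {0..1::real}) C"
  obtain h h' where h: "continuous_map ?Z T h" "\<forall>u. h (0, u) = s u" "\<forall>u. h (1, u) = s' u"
      "\<forall>r\<in>{0..1}. \<forall>u\<in>D. h (r, u) = f"
    and h': "continuous_map ?Z T' h'" "\<forall>u. h' (0, u) = t u" "\<forall>u. h' (1, u) = t' u"
      "\<forall>r\<in>{0..1}. \<forall>u\<in>D. h' (r, u) = g"
    using assms(2,3) unfolding homotopic_with_def by auto
  show ?thesis
    unfolding homotopic_with_def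
    using continuous_map_binary[OF K h(1) h'(1)] h h' by (intro exI[of _ "\<lambda>p. K (h p) (h' p)"]) simp
qed

lemma path_component_of_binary:
  assumes K: "continuous_map (prod_topology T T') T'' (\<lambda>(a, b). K a b)"
    and "path_component_of T a a'" "path_component_of T' b b'"
  shows "path_component_of T'' (K a b) (K a' b')"
proof -
  obtain p q where "pathin T p" "p 0 = a" "p 1 = a'" "pathin T' q" "q 0 = b" "q 1 = b'"
    using assms(2,3) by (auto simp: path_component_of_def)
  then show ?thesis
    unfolding path_component_of_def pathin_def
    by (intro exI[of _ "\<lambda>r. K (p r) (q r)"] conjI continuous_map_binary[OF K])
      (simp_all add: pathin_def)
qed

lemma htpy_rep_concat:
  assumes X: "is_dispace X"
    and s: "htpy_rep n (trace_space X x y) f s" and t: "htpy_rep n (trace_space X y z) g t"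
  shows "htpy_rep n (trace_space X x z) (trace_concat X f g) (\<lambda>u. trace_concat X (s u) (t u))"
proof -
  have "continuous_map (cube (n - 1)) (trace_space X x z) (\<lambda>u. trace_concat X (s u) (t u))"
    by (rule continuous_map_binary[OF continuous_map_trace_concat[OF X, of x y z]])
      (use s t in \<open>simp_all add: htpy_rep_def cube_maps_def\<close>)
  moreover have "\<forall>u \<in> cube_boundary (n - 1). trace_concat X (s u) (t u) = trace_concat X f g"
    using s t by (simp add: htpy_rep_def cube_maps_def)
  moreover have "n = 0 \<longrightarrow> trace_concat X (s (\<lambda>_. undefined)) (t (\<lambda>_. undefined)) = trace_concat X f g"
    using s t by (simp add: htpy_rep_def)
  ultimately show ?thesis unfolding htpy_rep_def cube_maps_def by blast
qed

text \<open>Any two choices of representatives are linked by paths or homotopies in each factor;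
  combining these shows that the union in \<open>nat_htpy_concat\<close> is over equal classes. From
  here on composition is computed on chosen representatives.\<close>

lemma nat_htpy_concat_elem:
  assumes X: "is_dispace X"
    and s: "htpy_rep n (trace_space X x y) f s" and t: "htpy_rep n (trace_space X y z) g t"
  shows "nat_htpy_concat n X x z f g
      (htpy_elem n (trace_space X x y) f s) (htpy_elem n (trace_space X y z) g t) =
    htpy_elem n (trace_space X x z) (trace_concat X f g) (\<lambda>u. trace_concat X (s u) (t u))"
proof -
  let ?T = "trace_space X x y" and ?T' = "trace_space X y z" and ?T'' = "trace_space X x z"
  let ?K = "trace_concat X"
  note K = continuous_map_trace_concat[OF X, of x y z]
  consider "n = 0" | "n = 1" | "n \<ge> 2" by linarith
  then show ?thesis
  proof cases
    case 2
    let ?a = "s (\<lambda>_. undefined)" and ?b = "t (\<lambda>_. undefined)"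
    have eq: "path_component_of_set ?T'' (?K a b) = path_component_of_set ?T'' (?K ?a ?b)"
      if "path_component_of ?T ?a a" "path_component_of ?T' ?b b" for a b
      using path_component_of_set_eq[OF path_component_of_binary[OF K that]] by simp
    have ab: "path_component_of ?T ?a ?a" "path_component_of ?T' ?b ?b"
      using htpy_rep_in_topspace[OF s] htpy_rep_in_topspace[OF t] 2
      by (simp_all add: topspace_cube_0 path_component_of_refl)
    have "(\<Union>a \<in> path_component_of_set ?T ?a. \<Union>b \<in> path_component_of_set ?T' ?b.
        path_component_of_set ?T'' (?K a b)) = path_component_of_set ?T'' (?K ?a ?b)"
      by (rule UN2_constant_eq[where F = "\<lambda>a b. path_component_of_set ?T'' (?K a b)"])
        (unfold mem_Collect_eq, rule ab, rule ab, rule eq)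
    then show ?thesis using 2 by (simp add: htpy_elem_def)
  next
    case 3
    let ?m = "n - 1"
    have "homotopy_class ?m ?T'' (?K f g) (\<lambda>u. ?K (s' u) (t' u)) =
        homotopy_class ?m ?T'' (?K f g) (\<lambda>u. ?K (s u) (t u))"
      if "s' \<in> homotopy_class ?m ?T f s" "t' \<in> homotopy_class ?m ?T' g t" for s' t'
      using homotopy_class_eq[OF homotopic_with_binary[OF K]] that by (simp add: homotopy_class_def)
    moreover have "s \<in> homotopy_class ?m ?T f s" "t \<in> homotopy_class ?m ?T' g t"
      using s t by (simp_all add: homotopy_class_self htpy_rep_def)
    ultimately have "(\<Union>s' \<in> homotopy_class ?m ?T f s. \<Union>t' \<in> homotopy_class ?m ?T' g t.
        homotopy_class ?m ?T'' (?K f g) (\<lambda>u. ?K (s' u) (t' u))) =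
        homotopy_class ?m ?T'' (?K f g) (\<lambda>u. ?K (s u) (t u))"
      by (intro UN2_constant_eq[where
            F = "\<lambda>s t. homotopy_class ?m ?T'' (?K f g) (\<lambda>u. ?K (s u) (t u))"])
    then show ?thesis using 3 by (simp add: htpy_elem_def)
  qed (simp add: htpy_elem_def)
qed


section \<open>Categories and functors\<close>

lemma is_functor_comp:
  assumes "is_functor C D F" "is_functor D E G"
  shows "is_functor C E (funct_comp G F)"
  using assms unfolding is_functor_def funct_comp_def by simp

lemma is_category_homD:
  assumes "is_category C" "f \<in> hom C x y" shows "x \<in> obj C" "y \<in> obj C"
  using assms unfolding is_category_def by blast+

lemma funct_eqI:
  fixes F G :: "('o, 'm, 'o2, 'm2) funct"
  assumes "funct_extensional C F" "funct_extensional C G"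
    and omap: "\<And>x. x \<in> obj C \<Longrightarrow> omap F x = omap G x"
    and mmap: "\<And>x y f. f \<in> hom C x y \<Longrightarrow> mmap F x y f = mmap G x y f"
  shows "F = G"
proof (rule funct.equality)
  show "omap F = omap G"
    using assms by (intro extensionalityI[of _ "obj C"]) (auto simp: funct_extensional_def)
  have "mmap F x y = mmap G x y" for x y
    using assms by (intro extensionalityI[of _ "hom C x y"]) (auto simp: funct_extensional_def)
  then show "mmap F = mmap G" by blast
qed simp

lemma is_category_op: "is_category C \<Longrightarrow> is_category (op_cat C)"
  unfolding is_category_def op_cat_def by simp

lemma op_op_cat [simp]: "op_cat (op_cat C) = C"
  by (simp add: op_cat_def)

lemma Cat_simps:
  "C \<in> obj Cat \<longleftrightarrow> is_category C"
  "F \<in> hom Cat C D \<longleftrightarrow> is_functor C D F \<and> funct_extensional C F"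
  by (simp_all add: Cat_def)

lemma ident_Cat: "is_category C \<Longrightarrow> ident Cat C \<in> hom Cat C C"
  unfolding Cat_simps
  by (auto simp: Cat_def is_functor_def funct_extensional_def is_category_def)

lemma cmp_Cat_simps:
  assumes "F \<in> hom Cat C D" "G \<in> hom Cat D E"
  shows "x \<in> obj C \<Longrightarrow> omap (cmp Cat C D E F G) x = omap G (omap F x)"
    and "f \<in> hom C x y \<Longrightarrow> mmap (cmp Cat C D E F G) x y f = mmap G (omap F x) (omap F y) (mmap F x y f)"
  by (simp_all add: Cat_def compose_def)

lemma cmp_Cat:
  assumes F: "F \<in> hom Cat C D" and G: "G \<in> hom Cat D E"
  shows "cmp Cat C D E F G \<in> hom Cat C E"
proof -
  have CD: "is_functor C D F" and DE: "is_functor D E G" using F G by (simp_all add: Cat_simps)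
  have C: "is_category C" using CD by (simp add: is_functor_def)
  have "is_functor C E (cmp Cat C D E F G)"
    unfolding is_functor_def
  proof (intro conjI ballI allI impI)
    show "is_category C" "is_category E" using CD DE by (simp_all add: is_functor_def)
    fix x assume "x \<in> obj C"
    moreover from this have "ident C x \<in> hom C x x" using C by (simp add: is_category_def)
    ultimately show "omap (cmp Cat C D E F G) x \<in> obj E"
      and "mmap (cmp Cat C D E F G) x x (ident C x) = ident E (omap (cmp Cat C D E F G) x)"
      using CD DE by (simp_all add: cmp_Cat_simps[OF F G] is_functor_def)
  next
    fix x y f assume f: "f \<in> hom C x y"
    with is_category_homD[OF C f]
    show "mmap (cmp Cat C D E F G) x y f \<in> hom E (omap (cmp Cat C D E F G) x) (omap (cmp Cat C D E F G) y)"
      using CD DE by (simp add: cmp_Cat_simps[OF F G] is_functor_def)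
  next
    fix x y z f g assume f: "f \<in> hom C x y" and g: "g \<in> hom C y z"
    then have "cmp C x y z f g \<in> hom C x z" using C by (simp add: is_category_def)
    with f g is_category_homD[OF C f] is_category_homD[OF C g]
    show "mmap (cmp Cat C D E F G) x z (cmp C x y z f g) =
        cmp E (omap (cmp Cat C D E F G) x) (omap (cmp Cat C D E F G) y) (omap (cmp Cat C D E F G) z)
          (mmap (cmp Cat C D E F G) x y f) (mmap (cmp Cat C D E F G) y z g)"
      using CD DE by (simp add: cmp_Cat_simps[OF F G] is_functor_def)
  qed
  moreover have "funct_extensional C (cmp Cat C D E F G)"
    by (simp add: Cat_def funct_extensional_def compose_def)
  ultimately show ?thesis by (simp add: Cat_simps)
qed

lemma Cat_hom_eqI:
  assumes "F \<in> hom Cat C D" "G \<in> hom Cat C E"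
    and "\<And>x. x \<in> obj C \<Longrightarrow> omap F x = omap G x"
    and "\<And>x y f. f \<in> hom C x y \<Longrightarrow> mmap F x y f = mmap G x y f"
  shows "F = G"
  using assms by (intro funct_eqI[of C]) (simp_all add: Cat_simps)

lemma ident_Cat_simps:
  "x \<in> obj C \<Longrightarrow> omap (ident Cat C) x = x"
  "f \<in> hom C x y \<Longrightarrow> mmap (ident Cat C) x y f = f"
  by (simp_all add: Cat_def)

lemma Cat_homD:
  assumes "F \<in> hom Cat C D"
  shows "is_category C" "is_category D"
    and "x \<in> obj C \<Longrightarrow> omap F x \<in> obj D"
    and "f \<in> hom C x y \<Longrightarrow> mmap F x y f \<in> hom D (omap F x) (omap F y)"
  using assms by (simp_all add: Cat_simps is_functor_def)

text \<open>Equality of morphisms is equality of records, hence the extensionality demanded in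
  \<open>Cat\<close>: both sides of a law are undefined off the source, and only values on objects
  and morphisms have to be compared.\<close>

lemma is_category_Cat: "is_category Cat"
  unfolding is_category_def
proof (intro conjI allI ballI impI)
  fix C D :: "('o, 'm) cat" and F assume F: "F \<in> hom Cat C D"
  note CD = Cat_homD(1,2)[OF F]
  show "C \<in> obj Cat" "D \<in> obj Cat" using CD by (simp_all add: Cat_simps)
  show "cmp Cat C C D (ident Cat C) F = F"
    using cmp_Cat[OF ident_Cat[OF CD(1)] F] F
  proof (rule Cat_hom_eqI)
    fix x y f assume f: "f \<in> hom C x y"
    then show "mmap (cmp Cat C C D (ident Cat C) F) x y f = mmap F x y f"
      using is_category_homD[OF CD(1) f] by (simp add: cmp_Cat_simps[OF ident_Cat[OF CD(1)] F] ident_Cat_simps)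
  qed (simp add: cmp_Cat_simps[OF ident_Cat[OF CD(1)] F] ident_Cat_simps)
  show "cmp Cat C D D F (ident Cat D) = F"
    using cmp_Cat[OF F ident_Cat[OF CD(2)]] F
    by (rule Cat_hom_eqI)
      (simp_all add: cmp_Cat_simps[OF F ident_Cat[OF CD(2)]] ident_Cat_simps Cat_homD(3,4)[OF F])
next
  fix A B C D :: "('o, 'm) cat" and F G H
  assume F: "F \<in> hom Cat A B" and G: "G \<in> hom Cat B C" and H: "H \<in> hom Cat C D"
  note FG = cmp_Cat[OF F G] and GH = cmp_Cat[OF G H]
  show "cmp Cat A C D (cmp Cat A B C F G) H = cmp Cat A B D F (cmp Cat B C D G H)"
    using cmp_Cat[OF FG H] cmp_Cat[OF F GH]
  proof (rule Cat_hom_eqI)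
    fix x y f assume f: "f \<in> hom A x y"
    then show "mmap (cmp Cat A C D (cmp Cat A B C F G) H) x y f = mmap (cmp Cat A B D F (cmp Cat B C D G H)) x y f"
      using is_category_homD[OF Cat_homD(1)[OF F] f]
      by (simp add: cmp_Cat_simps[OF FG H] cmp_Cat_simps[OF F GH] cmp_Cat_simps[OF F G] cmp_Cat_simps[OF G H]
          Cat_homD(3,4)[OF F])
  qed (simp add: cmp_Cat_simps[OF FG H] cmp_Cat_simps[OF F GH] cmp_Cat_simps[OF F G] cmp_Cat_simps[OF G H]
        Cat_homD(3)[OF F])
qed (simp_all add: Cat_simps ident_Cat[unfolded Cat_simps] cmp_Cat[unfolded Cat_simps])

lemma op_functor_mmap:
  assumes "F \<in> hom Cat C D"
  shows "mmap op_functor C' D' F \<in> hom Cat (op_cat C) (op_cat D)"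
  using assms is_category_op[of C] is_category_op[of D]
  by (simp add: Cat_simps is_functor_def funct_extensional_def op_functor_def op_cat_def)

lemma is_functor_op: "is_functor Cat Cat op_functor"
  unfolding is_functor_def
proof (intro conjI ballI allI impI)
  show "omap op_functor C \<in> obj Cat" if "C \<in> obj Cat" for C :: "('o, 'm) cat"
    using that by (simp add: op_functor_def Cat_simps is_category_op)
  show "mmap op_functor C D F \<in> hom Cat (omap op_functor C) (omap op_functor D)"
    if "F \<in> hom Cat C D" for C D :: "('o, 'm) cat" and F
    using op_functor_mmap[OF that] by (simp add: op_functor_def)
qed (simp_all add: is_category_Cat, simp_all add: op_functor_def Cat_def op_cat_def)


subsection \<open>The category of dispaces\<close>

lemma dmaps_ident:
  assumes X: "is_dispace X" shows "(\<lambda>x\<in>topspace (dtop X). x) \<in> dmaps X X"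
proof -
  have "compose {0..1} (\<lambda>x\<in>topspace (dtop X). x) f = f" if "f \<in> dpaths X" for f
    using dpaths_in_topspace[OF X that] dpaths_extensional[OF X that]
    by (fastforce simp: compose_def extensional_def)
  moreover have "continuous_map (dtop X) (dtop X) (\<lambda>x\<in>topspace (dtop X). x)"
    by (rule continuous_map_eq[OF continuous_map_id]) simp
  ultimately show ?thesis by (simp add: dmaps_def)
qed

lemma dmaps_compose:
  assumes X: "is_dispace X" and \<phi>: "\<phi> \<in> dmaps X Y" and \<psi>: "\<psi> \<in> dmaps Y Z"
  shows "compose (topspace (dtop X)) \<psi> \<phi> \<in> dmaps X Z"
proof -
  have "compose {0..1} (compose (topspace (dtop X)) \<psi> \<phi>) f = compose {0..1} \<psi> (compose {0..1} \<phi> f)"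
    if "f \<in> dpaths X" for f
    using dpaths_in_topspace[OF X that] by (auto simp: compose_def fun_eq_iff)
  moreover have "continuous_map (dtop X) (dtop Z) (compose (topspace (dtop X)) \<psi> \<phi>)"
    by (rule continuous_map_eq[of _ _ "\<psi> \<circ> \<phi>"])
      (use \<phi> \<psi> in \<open>auto simp: dmaps_def compose_def intro: continuous_map_compose\<close>)
  ultimately show ?thesis using \<phi> \<psi> by (simp add: dmaps_def)
qed

lemma dTop_simps:
  "X \<in> obj dTop \<longleftrightarrow> is_dispace X"
  "\<phi> \<in> hom dTop X Y \<longleftrightarrow> is_dispace X \<and> is_dispace Y \<and> \<phi> \<in> dmaps X Y"
  "ident dTop X = (\<lambda>x\<in>topspace (dtop X). x)"
  "cmp dTop X Y Z \<phi> \<psi> = compose (topspace (dtop X)) \<psi> \<phi>"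
  by (auto simp: dTop_def)

lemma is_category_dTop: "is_category dTop"
  unfolding is_category_def dTop_simps
proof (intro conjI allI ballI impI)
  fix X Y :: "'a dispace" and \<phi> assume \<phi>: "is_dispace X \<and> is_dispace Y \<and> \<phi> \<in> dmaps X Y"
  then have "\<phi> \<in> extensional (topspace (dtop X))" by (simp add: dmaps_def)
  then show "compose (topspace (dtop X)) \<phi> (\<lambda>x\<in>topspace (dtop X). x) = \<phi>"
      "compose (topspace (dtop X)) (\<lambda>x\<in>topspace (dtop Y). x) \<phi> = \<phi>"
    using \<phi> dmaps_topspace[of \<phi> X Y] by (auto simp: compose_def extensional_def fun_eq_iff)
next
  fix W X Y Z :: "'a dispace" and f g h
  assume "is_dispace W \<and> is_dispace X \<and> f \<in> dmaps W X"
  then show "compose (topspace (dtop W)) h (compose (topspace (dtop W)) g f) =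
      compose (topspace (dtop W)) (compose (topspace (dtop X)) h g) f"
    using dmaps_topspace[of f W X] by (auto simp: compose_def fun_eq_iff)
qed (auto simp: dTop_simps dmaps_ident dmaps_compose)

lemma is_functor_reversal: "is_functor dTop dTop reversal_functor"
  unfolding is_functor_def
  by (auto simp: is_category_dTop reversal_functor_def dTop_simps is_dispace_opp dmaps_opp)


section \<open>The categories of natural homotopy\<close>

lemma nat_htpy_cat_simps:
  "obj (nat_htpy_cat n X) = topspace (dtop X)"
  "ident (nat_htpy_cat n X) x =
    (htpy_elem n (trace_space X x x) (trace_id X x) (\<lambda>_. trace_id X x), trace_id X x)"
  by (simp_all add: nat_htpy_cat_def nat_htpy_base_eq)

lemma nat_htpy_cat_homI:
  assumes "is_dispace X" "f \<in> traces X x y" "htpy_rep n (trace_space X x y) f s"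
  shows "(htpy_elem n (trace_space X x y) f s, f) \<in> hom (nat_htpy_cat n X) x y"
  using assms by (simp add: nat_htpy_cat_def nat_htpy_set_eq)

lemma nat_htpy_cat_homE:
  assumes "is_dispace X" "m \<in> hom (nat_htpy_cat n X) x y"
  obtains f s where "f \<in> traces X x y" "htpy_rep n (trace_space X x y) f s"
    "m = (htpy_elem n (trace_space X x y) f s, f)"
  using assms by (auto simp: nat_htpy_cat_def nat_htpy_set_eq)

lemma cmp_nat_htpy_cat:
  assumes "is_dispace X"
    and "htpy_rep n (trace_space X x y) f s" "htpy_rep n (trace_space X y z) g t"
  shows "cmp (nat_htpy_cat n X) x y z
      (htpy_elem n (trace_space X x y) f s, f) (htpy_elem n (trace_space X y z) g t, g) =
    (htpy_elem n (trace_space X x z) (trace_concat X f g) (\<lambda>u. trace_concat X (s u) (t u)), trace_concat X f g)"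
  by (simp add: nat_htpy_cat_def nat_htpy_concat_elem[OF assms])

lemma htpy_rep_traces:
  "is_dispace X \<Longrightarrow> htpy_rep n (trace_space X x y) f s \<Longrightarrow> u \<in> topspace (cube (n - 1)) \<Longrightarrow> s u \<in> traces X x y"
  using htpy_rep_in_topspace topspace_trace_space by metis

lemma htpy_rep_trace_id:
  "is_dispace X \<Longrightarrow> x \<in> topspace (dtop X) \<Longrightarrow> htpy_rep n (trace_space X x x) (trace_id X x) (\<lambda>_. trace_id X x)"
  by (simp add: htpy_rep_const topspace_trace_space trace_id_in)

text \<open>Once representatives are chosen, each law is the corresponding strict law for traces,
  applied at every point of the cube and once more to the second components.\<close>

lemma is_category_nat_htpy_cat:
  assumes X: "is_dispace X" shows "is_category (nat_htpy_cat n X)"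
  unfolding is_category_def
proof (intro conjI allI ballI impI)
  fix x y m assume "m \<in> hom (nat_htpy_cat n X) x y"
  then obtain f s where f: "f \<in> traces X x y" and s: "htpy_rep n (trace_space X x y) f s"
    and m: "m = (htpy_elem n (trace_space X x y) f s, f)"
    by (rule nat_htpy_cat_homE[OF X])
  note xy = traces_endpoints[OF X f]
  show "x \<in> obj (nat_htpy_cat n X)" "y \<in> obj (nat_htpy_cat n X)"
    using xy by (simp_all add: nat_htpy_cat_simps)
  have left: "htpy_elem n (trace_space X x y) f s = htpy_elem n (trace_space X x y) f (\<lambda>u. trace_concat X (trace_id X x) (s u))"
    using s by (rule htpy_elem_cong) (simp add: trace_concat_id_left[OF X htpy_rep_traces[OF X s]])
  show "cmp (nat_htpy_cat n X) x x y (ident (nat_htpy_cat n X) x) m = m"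
    by (simp add: left[symmetric] m nat_htpy_cat_simps cmp_nat_htpy_cat[OF X htpy_rep_trace_id[OF X xy(1)] s]
        trace_concat_id_left[OF X f])
  have right: "htpy_elem n (trace_space X x y) f s = htpy_elem n (trace_space X x y) f (\<lambda>u. trace_concat X (s u) (trace_id X y))"
    using s by (rule htpy_elem_cong) (simp add: trace_concat_id_right[OF X htpy_rep_traces[OF X s]])
  show "cmp (nat_htpy_cat n X) x y y m (ident (nat_htpy_cat n X) y) = m"
    by (simp add: right[symmetric] m nat_htpy_cat_simps cmp_nat_htpy_cat[OF X s htpy_rep_trace_id[OF X xy(2)]]
        trace_concat_id_right[OF X f])
next
  fix x assume "x \<in> obj (nat_htpy_cat n X)"
  then show "ident (nat_htpy_cat n X) x \<in> hom (nat_htpy_cat n X) x x"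
    unfolding nat_htpy_cat_simps by (intro nat_htpy_cat_homI X trace_id_in htpy_rep_trace_id)
next
  fix x y z l m assume "l \<in> hom (nat_htpy_cat n X) x y" "m \<in> hom (nat_htpy_cat n X) y z"
  then show "cmp (nat_htpy_cat n X) x y z l m \<in> hom (nat_htpy_cat n X) x z"
    by (elim nat_htpy_cat_homE[OF X])
      (simp add: cmp_nat_htpy_cat[OF X] nat_htpy_cat_homI[OF X] trace_concat_in[OF X] htpy_rep_concat[OF X])
next
  fix w x y z k l m
  assume "k \<in> hom (nat_htpy_cat n X) w x" "l \<in> hom (nat_htpy_cat n X) x y" "m \<in> hom (nat_htpy_cat n X) y z"
  then obtain f s g t h r where f: "f \<in> traces X w x" and s: "htpy_rep n (trace_space X w x) f s"
    and g: "g \<in> traces X x y" and t: "htpy_rep n (trace_space X x y) g t"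
    and h: "h \<in> traces X y z" and r: "htpy_rep n (trace_space X y z) h r"
    and klm: "k = (htpy_elem n (trace_space X w x) f s, f)" "l = (htpy_elem n (trace_space X x y) g t, g)"
      "m = (htpy_elem n (trace_space X y z) h r, h)"
    by (elim nat_htpy_cat_homE[OF X])
  note st = htpy_rep_concat[OF X s t] and tr = htpy_rep_concat[OF X t r]
  have "htpy_elem n (trace_space X w z) (trace_concat X (trace_concat X f g) h)
        (\<lambda>u. trace_concat X (trace_concat X (s u) (t u)) (r u)) =
      htpy_elem n (trace_space X w z) (trace_concat X (trace_concat X f g) h)
        (\<lambda>u. trace_concat X (s u) (trace_concat X (t u) (r u)))"
    using htpy_rep_concat[OF X st r]
    by (rule htpy_elem_cong)
      (rule trace_concat_assoc[OF X htpy_rep_traces[OF X s] htpy_rep_traces[OF X t] htpy_rep_traces[OF X r]])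
  then show "cmp (nat_htpy_cat n X) w y z (cmp (nat_htpy_cat n X) w x y k l) m =
      cmp (nat_htpy_cat n X) w x z k (cmp (nat_htpy_cat n X) x y z l m)"
    unfolding klm cmp_nat_htpy_cat[OF X s t] cmp_nat_htpy_cat[OF X t r] cmp_nat_htpy_cat[OF X st r]
      cmp_nat_htpy_cat[OF X s tr] trace_concat_assoc[OF X f g h, symmetric]
    by simp
qed


subsection \<open>Functoriality\<close>

lemma nat_htpy_cat_map_simps:
  assumes X: "is_dispace X" and Y: "is_dispace Y" and \<phi>: "\<phi> \<in> dmaps X Y"
  shows "x \<in> topspace (dtop X) \<Longrightarrow> omap (nat_htpy_cat_map n X Y \<phi>) x = \<phi> x"
    and "f \<in> traces X x y \<Longrightarrow> htpy_rep n (trace_space X x y) f s \<Longrightarrow>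
      mmap (nat_htpy_cat_map n X Y \<phi>) x y (htpy_elem n (trace_space X x y) f s, f) =
      (htpy_elem n (trace_space Y (\<phi> x) (\<phi> y)) (trace_map Y \<phi> f) (\<lambda>u. trace_map Y \<phi> (s u)), trace_map Y \<phi> f)"
  by (simp_all add: nat_htpy_cat_map_def nat_htpy_cat_homI[OF X] nat_htpy_map_eq
      nat_htpy_pushforward_elem[OF _ continuous_map_trace_map[OF X Y \<phi>]])

lemma htpy_rep_trace_map:
  assumes "is_dispace X" "is_dispace Y" "\<phi> \<in> dmaps X Y" "htpy_rep n (trace_space X x y) f s"
  shows "htpy_rep n (trace_space Y (\<phi> x) (\<phi> y)) (trace_map Y \<phi> f) (\<lambda>u. trace_map Y \<phi> (s u))"
  using htpy_rep_pushforward[OF assms(4) continuous_map_trace_map[OF assms(1-3)]] .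

lemma nat_htpy_cat_map_in:
  assumes X: "is_dispace X" and Y: "is_dispace Y" and \<phi>: "\<phi> \<in> dmaps X Y"
  shows "nat_htpy_cat_map n X Y \<phi> \<in> hom Cat (nat_htpy_cat n X) (nat_htpy_cat n Y)"
proof -
  note simps = nat_htpy_cat_map_simps[OF X Y \<phi>] and rep = htpy_rep_trace_map[OF X Y \<phi>]
  have "is_functor (nat_htpy_cat n X) (nat_htpy_cat n Y) (nat_htpy_cat_map n X Y \<phi>)"
    unfolding is_functor_def
  proof (intro conjI ballI allI impI)
    fix x assume "x \<in> obj (nat_htpy_cat n X)"
    then have x: "x \<in> topspace (dtop X)" by (simp add: nat_htpy_cat_simps)
    then show "omap (nat_htpy_cat_map n X Y \<phi>) x \<in> obj (nat_htpy_cat n Y)"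
      using dmaps_topspace[OF \<phi>] by (simp add: simps nat_htpy_cat_simps)
    show "mmap (nat_htpy_cat_map n X Y \<phi>) x x (ident (nat_htpy_cat n X) x) =
        ident (nat_htpy_cat n Y) (omap (nat_htpy_cat_map n X Y \<phi>) x)"
      using x by (simp add: simps nat_htpy_cat_simps trace_id_in[OF X] htpy_rep_trace_id[OF X] trace_map_id[OF X _ Y \<phi>])
  next
    fix x y m assume "m \<in> hom (nat_htpy_cat n X) x y"
    then obtain f s where f: "f \<in> traces X x y" and s: "htpy_rep n (trace_space X x y) f s"
      and m: "m = (htpy_elem n (trace_space X x y) f s, f)"
      by (rule nat_htpy_cat_homE[OF X])
    show "mmap (nat_htpy_cat_map n X Y \<phi>) x y m \<in>
        hom (nat_htpy_cat n Y) (omap (nat_htpy_cat_map n X Y \<phi>) x) (omap (nat_htpy_cat_map n X Y \<phi>) y)"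
      using traces_endpoints[OF X f]
      by (simp add: m simps f s nat_htpy_cat_homI[OF Y] trace_map_in[OF Y \<phi> f] rep)
  next
    fix x y z l m assume "l \<in> hom (nat_htpy_cat n X) x y" "m \<in> hom (nat_htpy_cat n X) y z"
    then obtain f s g t where f: "f \<in> traces X x y" and s: "htpy_rep n (trace_space X x y) f s"
      and g: "g \<in> traces X y z" and t: "htpy_rep n (trace_space X y z) g t"
      and lm: "l = (htpy_elem n (trace_space X x y) f s, f)" "m = (htpy_elem n (trace_space X y z) g t, g)"
      by (elim nat_htpy_cat_homE[OF X])
    note st = htpy_rep_concat[OF X s t]
    have "htpy_elem n (trace_space Y (\<phi> x) (\<phi> z)) (trace_map Y \<phi> (trace_concat X f g))
          (\<lambda>u. trace_map Y \<phi> (trace_concat X (s u) (t u))) =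
        htpy_elem n (trace_space Y (\<phi> x) (\<phi> z)) (trace_map Y \<phi> (trace_concat X f g))
          (\<lambda>u. trace_concat Y (trace_map Y \<phi> (s u)) (trace_map Y \<phi> (t u)))"
      using rep[OF st]
      by (rule htpy_elem_cong)
        (rule trace_map_concat[OF X Y \<phi> htpy_rep_traces[OF X s] htpy_rep_traces[OF X t]])
    then show "mmap (nat_htpy_cat_map n X Y \<phi>) x z (cmp (nat_htpy_cat n X) x y z l m) =
        cmp (nat_htpy_cat n Y) (omap (nat_htpy_cat_map n X Y \<phi>) x) (omap (nat_htpy_cat_map n X Y \<phi>) y)
          (omap (nat_htpy_cat_map n X Y \<phi>) z) (mmap (nat_htpy_cat_map n X Y \<phi>) x y l)
          (mmap (nat_htpy_cat_map n X Y \<phi>) y z m)"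
      using traces_endpoints[OF X f] traces_endpoints[OF X g] trace_concat_in[OF X f g]
      by (simp add: lm simps f g s t st rep cmp_nat_htpy_cat[OF X] cmp_nat_htpy_cat[OF Y]
          trace_map_concat[OF X Y \<phi> f g])
  qed (simp_all add: is_category_nat_htpy_cat X Y)
  moreover have "funct_extensional (nat_htpy_cat n X) (nat_htpy_cat_map n X Y \<phi>)"
    by (simp add: funct_extensional_def nat_htpy_cat_map_def nat_htpy_cat_simps)
  ultimately show ?thesis by (simp add: Cat_simps)
qed

lemma nat_htpy_cat_map_ident:
  assumes X: "is_dispace X"
  shows "nat_htpy_cat_map n X X (\<lambda>x\<in>topspace (dtop X). x) = ident Cat (nat_htpy_cat n X)"
    (is "nat_htpy_cat_map n X X ?id = _")
proof -
  note id = dmaps_ident[OF X]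
  show ?thesis
    using nat_htpy_cat_map_in[OF X X id] ident_Cat[OF is_category_nat_htpy_cat[OF X]]
  proof (rule Cat_hom_eqI)
    fix x assume "x \<in> obj (nat_htpy_cat n X)"
    then show "omap (nat_htpy_cat_map n X X ?id) x = omap (ident Cat (nat_htpy_cat n X)) x"
      by (simp add: ident_Cat_simps nat_htpy_cat_map_simps[OF X X id]) (simp add: nat_htpy_cat_simps nat_htpy_cat_map_def)
  next
    fix x y m assume hom: "m \<in> hom (nat_htpy_cat n X) x y"
    then obtain f s where f: "f \<in> traces X x y" and s: "htpy_rep n (trace_space X x y) f s"
      and m: "m = (htpy_elem n (trace_space X x y) f s, f)"
      by (rule nat_htpy_cat_homE[OF X])
    have eq: "htpy_elem n (trace_space X x y) f s = htpy_elem n (trace_space X x y) f (\<lambda>u. trace_map X ?id (s u))"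
      using s by (rule htpy_elem_cong) (rule trace_map_ident[OF X htpy_rep_traces[OF X s] id, symmetric])
    show "mmap (nat_htpy_cat_map n X X ?id) x y m = mmap (ident Cat (nat_htpy_cat n X)) x y m"
      unfolding ident_Cat_simps(2)[OF hom]
      using traces_endpoints[OF X f]
      by (simp add: eq[symmetric] m nat_htpy_cat_map_simps(2)[OF X X id f s] trace_map_ident[OF X f id])
  qed
qed

lemma nat_htpy_cat_map_compose:
  assumes X: "is_dispace X" and Y: "is_dispace Y" and Z: "is_dispace Z"
    and \<phi>: "\<phi> \<in> dmaps X Y" and \<psi>: "\<psi> \<in> dmaps Y Z"
  shows "nat_htpy_cat_map n X Z (compose (topspace (dtop X)) \<psi> \<phi>) =
    cmp Cat (nat_htpy_cat n X) (nat_htpy_cat n Y) (nat_htpy_cat n Z)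
      (nat_htpy_cat_map n X Y \<phi>) (nat_htpy_cat_map n Y Z \<psi>)"
    (is "nat_htpy_cat_map n X Z ?\<psi>\<phi> = cmp Cat ?X ?Y ?Z ?F ?G")
proof -
  note \<psi>\<phi> = dmaps_compose[OF X \<phi> \<psi>]
  note F = nat_htpy_cat_map_in[OF X Y \<phi>, of n] and G = nat_htpy_cat_map_in[OF Y Z \<psi>, of n]
  show ?thesis
    using nat_htpy_cat_map_in[OF X Z \<psi>\<phi>] cmp_Cat[OF F G]
  proof (rule Cat_hom_eqI)
    fix x assume x: "x \<in> obj ?X"
    then show "omap (nat_htpy_cat_map n X Z ?\<psi>\<phi>) x = omap (cmp Cat ?X ?Y ?Z ?F ?G) x"
      using dmaps_topspace[OF \<phi>, of x]
      by (simp add: cmp_Cat_simps(1)[OF F G x])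
        (simp add: nat_htpy_cat_simps nat_htpy_cat_map_simps[OF X Y \<phi>] nat_htpy_cat_map_simps[OF Y Z \<psi>]
          nat_htpy_cat_map_simps[OF X Z \<psi>\<phi>] compose_eq)
  next
    fix x y m assume hom: "m \<in> hom ?X x y"
    then obtain f s where f: "f \<in> traces X x y" and s: "htpy_rep n (trace_space X x y) f s"
      and m: "m = (htpy_elem n (trace_space X x y) f s, f)"
      by (rule nat_htpy_cat_homE[OF X])
    note xy = traces_endpoints[OF X f]
    \<comment> \<open>The composite in \<open>dTop\<close> is restricted to the carrier; the ends of
      a trace lie in it, so the restriction is invisible here.\<close>
    have eq: "?\<psi>\<phi> x = \<psi> (\<phi> x)" "?\<psi>\<phi> y = \<psi> (\<phi> y)" using xy by (simp_all add: compose_def)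
    have "htpy_elem n (trace_space Z (\<psi> (\<phi> x)) (\<psi> (\<phi> y))) (trace_map Z \<psi> (trace_map Y \<phi> f)) (\<lambda>u. trace_map Z \<psi> (trace_map Y \<phi> (s u))) =
      htpy_elem n (trace_space Z (\<psi> (\<phi> x)) (\<psi> (\<phi> y))) (trace_map Z \<psi> (trace_map Y \<phi> f)) (\<lambda>u. trace_map Z ?\<psi>\<phi> (s u))"
      using htpy_rep_trace_map[OF Y Z \<psi> htpy_rep_trace_map[OF X Y \<phi> s]]
      by (rule htpy_elem_cong) (rule trace_map_compose[OF X Y Z \<phi> \<psi> \<psi>\<phi> htpy_rep_traces[OF X s], symmetric])
    then show "mmap (nat_htpy_cat_map n X Z ?\<psi>\<phi>) x y m = mmap (cmp Cat ?X ?Y ?Z ?F ?G) x y m"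
      unfolding cmp_Cat_simps(2)[OF F G hom]
      by (simp add: m nat_htpy_cat_map_simps(2)[OF X Z \<psi>\<phi> f s] nat_htpy_cat_map_simps(2)[OF X Y \<phi> f s]
          nat_htpy_cat_map_simps(1)[OF X Y \<phi>] xy
          nat_htpy_cat_map_simps(2)[OF Y Z \<psi> trace_map_in[OF Y \<phi> f] htpy_rep_trace_map[OF X Y \<phi> s]]
          trace_map_compose[OF X Y Z \<phi> \<psi> \<psi>\<phi> f] eq)
  qed
qed

lemma is_functor_nat_htpy: "is_functor dTop Cat (nat_htpy_functor n)"
  unfolding is_functor_def dTop_simps
  by (auto simp: dTop_simps(1) is_category_dTop is_category_Cat nat_htpy_functor_def Cat_simps(1) is_category_nat_htpy_cat
      nat_htpy_cat_map_in nat_htpy_cat_map_ident nat_htpy_cat_map_compose)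


subsection \<open>Reversal\<close>

text \<open>The swapped ends \<open>y x\<close> match the hom-sets of the target, which is the
  opposite of the category of \<open>opp_dispace X\<close>. Both maps are restricted to the source,
  as \<open>Cat\<close> demands of its morphisms.\<close>

definition nat_htpy_cat_reverse ::
  "nat \<Rightarrow> 'a dispace \<Rightarrow> ('a, 'a nat_htpy \<times> 'a trace, 'a, 'a nat_htpy \<times> 'a trace) funct" where
  "nat_htpy_cat_reverse n X =
    \<lparr>omap = (\<lambda>x \<in> topspace (dtop X). x),
     mmap = (\<lambda>x y. \<lambda>(\<sigma>, f) \<in> hom (nat_htpy_cat n X) x y.
       (nat_htpy_pushforward n (trace_space (opp_dispace X) y x) trace_reverse f \<sigma>, trace_reverse f))\<rparr>"

lemma nat_htpy_cat_reverse_simps: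
  assumes X: "is_dispace X"
  shows "x \<in> topspace (dtop X) \<Longrightarrow> omap (nat_htpy_cat_reverse n X) x = x"
    and "f \<in> traces X x y \<Longrightarrow> htpy_rep n (trace_space X x y) f s \<Longrightarrow>
      mmap (nat_htpy_cat_reverse n X) x y (htpy_elem n (trace_space X x y) f s, f) =
      (htpy_elem n (trace_space (opp_dispace X) y x) (trace_reverse f) (\<lambda>u. trace_reverse (s u)), trace_reverse f)"
  by (simp_all add: nat_htpy_cat_reverse_def nat_htpy_cat_homI[OF X]
      nat_htpy_pushforward_elem[OF _ continuous_map_trace_reverse[OF X]])

lemma htpy_rep_trace_reverse:
  assumes "is_dispace X" "htpy_rep n (trace_space X x y) f s"
  shows "htpy_rep n (trace_space (opp_dispace X) y x) (trace_reverse f) (\<lambda>u. trace_reverse (s u))"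
  using htpy_rep_pushforward[OF assms(2) continuous_map_trace_reverse[OF assms(1)]] .

lemma op_cat_simps:
  "obj (op_cat C) = obj C" "hom (op_cat C) x y = hom C y x"
  "ident (op_cat C) = ident C" "cmp (op_cat C) x y z f g = cmp C z y x g f"
  by (simp_all add: op_cat_def)

lemma nat_htpy_cat_reverse_in:
  assumes X: "is_dispace X"
  shows "nat_htpy_cat_reverse n X \<in> hom Cat (nat_htpy_cat n X) (op_cat (nat_htpy_cat n (opp_dispace X)))"
    (is "?R \<in> hom Cat ?C (op_cat ?D)")
proof -
  note simps = nat_htpy_cat_reverse_simps[OF X] and rep = htpy_rep_trace_reverse[OF X]
    and X' = is_dispace_opp[OF X]
  have "is_functor ?C (op_cat ?D) ?R"
    unfolding is_functor_def op_cat_simps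
  proof (intro conjI ballI allI impI)
    fix x assume "x \<in> obj ?C"
    then have x: "x \<in> topspace (dtop X)" by (simp add: nat_htpy_cat_simps)
    then show "omap ?R x \<in> obj ?D" by (simp add: simps nat_htpy_cat_simps)
    show "mmap ?R x x (ident ?C x) = ident ?D (omap ?R x)"
      using x by (simp add: simps nat_htpy_cat_simps trace_id_in[OF X] htpy_rep_trace_id[OF X] trace_reverse_id[OF X])
  next
    fix x y m assume "m \<in> hom ?C x y"
    then obtain f s where f: "f \<in> traces X x y" and s: "htpy_rep n (trace_space X x y) f s"
      and m: "m = (htpy_elem n (trace_space X x y) f s, f)"
      by (rule nat_htpy_cat_homE[OF X])
    show "mmap ?R x y m \<in> hom ?D (omap ?R y) (omap ?R x)"
      using traces_endpoints[OF X f]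
      by (simp add: m simps f s nat_htpy_cat_homI[OF X'] trace_reverse_in[OF X f] rep)
  next
    fix x y z l m assume "l \<in> hom ?C x y" "m \<in> hom ?C y z"
    then obtain f s g t where f: "f \<in> traces X x y" and s: "htpy_rep n (trace_space X x y) f s"
      and g: "g \<in> traces X y z" and t: "htpy_rep n (trace_space X y z) g t"
      and lm: "l = (htpy_elem n (trace_space X x y) f s, f)" "m = (htpy_elem n (trace_space X y z) g t, g)"
      by (elim nat_htpy_cat_homE[OF X])
    note st = htpy_rep_concat[OF X s t]
    have "htpy_elem n (trace_space (opp_dispace X) z x) (trace_reverse (trace_concat X f g))
          (\<lambda>u. trace_reverse (trace_concat X (s u) (t u))) =
        htpy_elem n (trace_space (opp_dispace X) z x) (trace_reverse (trace_concat X f g))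
          (\<lambda>u. trace_concat (opp_dispace X) (trace_reverse (t u)) (trace_reverse (s u)))"
      using rep[OF st]
      by (rule htpy_elem_cong)
        (rule trace_reverse_concat[OF X htpy_rep_traces[OF X s] htpy_rep_traces[OF X t]])
    then show "mmap ?R x z (cmp ?C x y z l m) =
        cmp ?D (omap ?R z) (omap ?R y) (omap ?R x) (mmap ?R y z m) (mmap ?R x y l)"
      using traces_endpoints[OF X f] traces_endpoints[OF X g] trace_concat_in[OF X f g]
      by (simp add: lm simps f g s t st rep cmp_nat_htpy_cat[OF X] cmp_nat_htpy_cat[OF X']
          trace_reverse_concat[OF X f g])
  qed (simp_all add: is_category_nat_htpy_cat is_category_op X X')
  moreover have "funct_extensional ?C ?R"
    by (simp add: funct_extensional_def nat_htpy_cat_reverse_def nat_htpy_cat_simps)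
  ultimately show ?thesis by (simp add: Cat_simps)
qed

lemma op_functor_simps:
  "omap op_functor C = op_cat C"
  "omap (mmap op_functor C D F) = omap F"
  "mmap (mmap op_functor C D F) x y = mmap F y x"
  by (simp_all add: op_functor_def)

text \<open>Reversal acts on a path by precomposition and \<open>\<phi>\<close> by postcomposition,
  so the two commute; the resulting identity of traces lifts to natural homotopy through
  representatives.\<close>

lemma nat_htpy_cat_reverse_natural:
  assumes X: "is_dispace X" and Y: "is_dispace Y" and \<phi>: "\<phi> \<in> dmaps X Y"
  shows "cmp Cat (nat_htpy_cat n X) (nat_htpy_cat n Y) (op_cat (nat_htpy_cat n (opp_dispace Y)))
      (nat_htpy_cat_map n X Y \<phi>) (nat_htpy_cat_reverse n Y) =
    cmp Cat (nat_htpy_cat n X) (op_cat (nat_htpy_cat n (opp_dispace X))) (op_cat (nat_htpy_cat n (opp_dispace Y)))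
      (nat_htpy_cat_reverse n X)
      (mmap op_functor C D (nat_htpy_cat_map n (opp_dispace X) (opp_dispace Y) \<phi>))"
    (is "cmp Cat ?X ?Y ?Y' ?F ?S = cmp Cat ?X ?X' ?Y' ?R ?G")
proof -
  note X' = is_dispace_opp[OF X] and Y' = is_dispace_opp[OF Y] and \<phi>' = dmaps_opp[OF \<phi>]
  note F = nat_htpy_cat_map_in[OF X Y \<phi>, of n] and S = nat_htpy_cat_reverse_in[OF Y, of n]
    and R = nat_htpy_cat_reverse_in[OF X, of n]
    and G = op_functor_mmap[OF nat_htpy_cat_map_in[OF X' Y' \<phi>', of n], of C D]
  show ?thesis
    using cmp_Cat[OF F S] cmp_Cat[OF R G]
  proof (rule Cat_hom_eqI)
    fix x assume x: "x \<in> obj ?X"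
    then have "x \<in> topspace (dtop X)" by (simp add: nat_htpy_cat_simps)
    then show "omap (cmp Cat ?X ?Y ?Y' ?F ?S) x = omap (cmp Cat ?X ?X' ?Y' ?R ?G) x"
      unfolding cmp_Cat_simps(1)[OF F S x] cmp_Cat_simps(1)[OF R G x] op_functor_simps
      using dmaps_topspace[OF \<phi>]
      by (simp add: nat_htpy_cat_map_simps(1)[OF X Y \<phi>] nat_htpy_cat_map_simps(1)[OF X' Y' \<phi>']
          nat_htpy_cat_reverse_simps(1)[OF X] nat_htpy_cat_reverse_simps(1)[OF Y])
  next
    fix x y m assume hom: "m \<in> hom ?X x y"
    then obtain f s where f: "f \<in> traces X x y" and s: "htpy_rep n (trace_space X x y) f s"
      and m: "m = (htpy_elem n (trace_space X x y) f s, f)"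
      by (rule nat_htpy_cat_homE[OF X])
    note xy = traces_endpoints[OF X f]
    have "htpy_elem n (trace_space (opp_dispace Y) (\<phi> y) (\<phi> x)) (trace_reverse (trace_map Y \<phi> f))
          (\<lambda>u. trace_reverse (trace_map Y \<phi> (s u))) =
        htpy_elem n (trace_space (opp_dispace Y) (\<phi> y) (\<phi> x)) (trace_reverse (trace_map Y \<phi> f))
          (\<lambda>u. trace_map (opp_dispace Y) \<phi> (trace_reverse (s u)))"
      using htpy_rep_trace_reverse[OF Y htpy_rep_trace_map[OF X Y \<phi> s]]
      by (rule htpy_elem_cong) (rule trace_reverse_map[OF X Y \<phi> htpy_rep_traces[OF X s]])
    then show "mmap (cmp Cat ?X ?Y ?Y' ?F ?S) x y m = mmap (cmp Cat ?X ?X' ?Y' ?R ?G) x y m"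
      unfolding cmp_Cat_simps(2)[OF F S hom] cmp_Cat_simps(2)[OF R G hom] op_functor_simps
      by (simp add: m xy nat_htpy_cat_map_simps(1)[OF X Y \<phi>] nat_htpy_cat_reverse_simps(1)[OF X]
          nat_htpy_cat_map_simps(2)[OF X Y \<phi> f s] nat_htpy_cat_reverse_simps(2)[OF X f s]
          nat_htpy_cat_reverse_simps(2)[OF Y trace_map_in[OF Y \<phi> f] htpy_rep_trace_map[OF X Y \<phi> s]]
          nat_htpy_cat_map_simps(2)[OF X' Y' \<phi>' trace_reverse_in[OF X f] htpy_rep_trace_reverse[OF X s]]
          trace_reverse_map[OF X Y \<phi> f])
  qed
qed

text \<open>Taking opposites turns the second reversal into a functor that starts where the first
  one ends, so the involution on traces becomes an inverse law in \<open>Cat\<close>.\<close>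

lemma nat_htpy_cat_reverse_reverse:
  assumes X: "is_dispace X"
  shows "cmp Cat (nat_htpy_cat n X) (op_cat (nat_htpy_cat n (opp_dispace X))) (nat_htpy_cat n X)
      (nat_htpy_cat_reverse n X) (mmap op_functor C D (nat_htpy_cat_reverse n (opp_dispace X))) =
    ident Cat (nat_htpy_cat n X)"
    (is "cmp Cat ?X ?X' ?X ?R ?S = _")
proof -
  note X' = is_dispace_opp[OF X]
  note R = nat_htpy_cat_reverse_in[OF X, of n]
    and S = op_functor_mmap[OF nat_htpy_cat_reverse_in[OF X', of n], of C D, unfolded opp_opp_dispace[OF X] op_op_cat]
  show ?thesis
    using cmp_Cat[OF R S] ident_Cat[OF is_category_nat_htpy_cat[OF X]]
  proof (rule Cat_hom_eqI)
    fix x assume x: "x \<in> obj ?X"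
    then have "x \<in> topspace (dtop X)" by (simp add: nat_htpy_cat_simps)
    then show "omap (cmp Cat ?X ?X' ?X ?R ?S) x = omap (ident Cat ?X) x"
      unfolding cmp_Cat_simps(1)[OF R S x] op_functor_simps ident_Cat_simps(1)[OF x]
      by (simp add: nat_htpy_cat_reverse_simps(1)[OF X] nat_htpy_cat_reverse_simps(1)[OF X'])
  next
    fix x y m assume hom: "m \<in> hom ?X x y"
    then obtain f s where f: "f \<in> traces X x y" and s: "htpy_rep n (trace_space X x y) f s"
      and m: "m = (htpy_elem n (trace_space X x y) f s, f)"
      by (rule nat_htpy_cat_homE[OF X])
    note xy = traces_endpoints[OF X f]
    have eq: "htpy_elem n (trace_space X x y) f s =
        htpy_elem n (trace_space X x y) f (\<lambda>u. trace_reverse (trace_reverse (s u)))"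
      using s by (rule htpy_elem_cong) (rule trace_reverse_involutive[OF X htpy_rep_traces[OF X s], symmetric])
    show "mmap (cmp Cat ?X ?X' ?X ?R ?S) x y m = mmap (ident Cat ?X) x y m"
      unfolding cmp_Cat_simps(2)[OF R S hom] op_functor_simps ident_Cat_simps(2)[OF hom]
      by (simp add: eq[symmetric] m xy nat_htpy_cat_reverse_simps(1)[OF X] nat_htpy_cat_reverse_simps(2)[OF X f s]
          nat_htpy_cat_reverse_simps(2)[OF X' trace_reverse_in[OF X f] htpy_rep_trace_reverse[OF X s]]
          opp_opp_dispace[OF X] trace_reverse_involutive[OF X f])
  qed
qed

lemma nat_htpy_cat_reverse_iso:
  assumes X: "is_dispace X"
  shows "is_iso Cat (nat_htpy_cat n (opp_dispace X)) (op_cat (nat_htpy_cat n X)) (nat_htpy_cat_reverse n (opp_dispace X))"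
    (is "is_iso Cat ?X' ?X ?S")
  unfolding is_iso_def
proof (intro conjI bexI)
  note X' = is_dispace_opp[OF X]
  let ?G = "mmap op_functor (nat_htpy_cat n X) (op_cat ?X') (nat_htpy_cat_reverse n X)"
  note R = nat_htpy_cat_reverse_in[OF X, of n]
  show S: "?S \<in> hom Cat ?X' ?X"
    using nat_htpy_cat_reverse_in[OF X'] by (simp add: opp_opp_dispace[OF X])
  show "?G \<in> hom Cat ?X ?X'"
    using op_functor_mmap[OF R] by simp
  show "cmp Cat ?X' ?X ?X' ?S ?G = ident Cat ?X'"
    using nat_htpy_cat_reverse_reverse[OF X', of n] by (simp add: opp_opp_dispace[OF X])
  have T: "mmap op_functor ?X' ?X ?S \<in> hom Cat (op_cat ?X') (nat_htpy_cat n X)"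
    using op_functor_mmap[OF S] by simp
  have "mmap op_functor (op_cat ?X') (nat_htpy_cat n X) (mmap op_functor ?X' ?X ?S) = ?S"
    by (simp add: op_functor_def)
  \<comment> \<open>The second inverse law is the round trip starting at \<open>X\<close>,
    transported by functoriality of \<open>op_functor\<close>. Since taking opposites twice restores
    a functor, the outcome is the composite of \<open>?G\<close> and \<open>?S\<close>.\<close>
  moreover have "mmap op_functor (nat_htpy_cat n X) (nat_htpy_cat n X)
      (cmp Cat (nat_htpy_cat n X) (op_cat ?X') (nat_htpy_cat n X) (nat_htpy_cat_reverse n X) (mmap op_functor ?X' ?X ?S)) =
      cmp Cat ?X ?X' ?X ?G (mmap op_functor (op_cat ?X') (nat_htpy_cat n X) (mmap op_functor ?X' ?X ?S))"
    using is_functor_op R T unfolding is_functor_def op_functor_simps(1) by (metis op_op_cat)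
  moreover have "mmap op_functor (nat_htpy_cat n X) (nat_htpy_cat n X) (ident Cat (nat_htpy_cat n X)) = ident Cat ?X"
    by (simp add: op_functor_def Cat_def op_cat_simps)
  ultimately show "cmp Cat ?X ?X' ?X ?G ?S = ident Cat ?X"
    using nat_htpy_cat_reverse_reverse[OF X, of n ?X' ?X] by simp
qed

theorem theorem4p2p3:
  fixes n :: nat
  shows "strongly_time_reversal
    (nat_htpy_functor n ::
      ('a dispace, 'a \<Rightarrow> 'a, ('a, 'a nat_htpy \<times> 'a trace) cat,
       ('a, 'a nat_htpy \<times> 'a trace, 'a, 'a nat_htpy \<times> 'a trace) funct) funct)"
proof -
  let ?F = "nat_htpy_functor n ::
      ('a dispace, 'a \<Rightarrow> 'a, ('a, 'a nat_htpy \<times> 'a trace) cat,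
       ('a, 'a nat_htpy \<times> 'a trace, 'a, 'a nat_htpy \<times> 'a trace) funct) funct"
  \<comment> \<open>The component at \<open>X\<close> has to start at the category of
    \<open>opp_dispace X\<close>, so reversal is taken there; by double reversal its target is the
    opposite of the category of \<open>X\<close>.\<close>
  let ?\<eta> = "\<lambda>X :: 'a dispace. nat_htpy_cat_reverse n (opp_dispace X)"
  have omaps: "omap (funct_comp ?F reversal_functor) X = nat_htpy_cat n (opp_dispace X)"
    "omap (funct_comp op_functor ?F) X = op_cat (nat_htpy_cat n X)" for X
    by (simp_all add: funct_comp_def nat_htpy_functor_def reversal_functor_def op_functor_def)
  have mmaps: "mmap (funct_comp ?F reversal_functor) X Y \<phi> = nat_htpy_cat_map n (opp_dispace X) (opp_dispace Y) \<phi>"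
    "mmap (funct_comp op_functor ?F) X Y \<phi> =
      mmap op_functor (nat_htpy_cat n X) (nat_htpy_cat n Y) (nat_htpy_cat_map n X Y \<phi>)" for X Y \<phi>
    by (simp_all add: funct_comp_def nat_htpy_functor_def reversal_functor_def)
  have iso: "is_iso Cat (nat_htpy_cat n (opp_dispace X)) (op_cat (nat_htpy_cat n X)) (?\<eta> X)"
    if "is_dispace X" for X
    by (rule nat_htpy_cat_reverse_iso[OF that])
  have "natural_transformation dTop Cat (funct_comp ?F reversal_functor) (funct_comp op_functor ?F) ?\<eta>"
    unfolding natural_transformation_def omaps mmaps dTop_simps
  proof (intro conjI allI ballI impI)
    show "is_functor dTop Cat (funct_comp ?F reversal_functor)"
      by (rule is_functor_comp[OF is_functor_reversal is_functor_nat_htpy])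
    show "is_functor dTop Cat (funct_comp op_functor ?F)"
      by (rule is_functor_comp[OF is_functor_nat_htpy is_functor_op])
  next
    fix X :: "'a dispace" assume "X \<in> obj dTop"
    then show "?\<eta> X \<in> hom Cat (nat_htpy_cat n (opp_dispace X)) (op_cat (nat_htpy_cat n X))"
      using iso by (simp add: dTop_simps is_iso_def)
  next
    fix X Y :: "'a dispace" and \<phi> assume "is_dispace X \<and> is_dispace Y \<and> \<phi> \<in> dmaps X Y"
    then show "cmp Cat (nat_htpy_cat n (opp_dispace X)) (nat_htpy_cat n (opp_dispace Y)) (op_cat (nat_htpy_cat n Y))
        (nat_htpy_cat_map n (opp_dispace X) (opp_dispace Y) \<phi>) (?\<eta> Y) =
      cmp Cat (nat_htpy_cat n (opp_dispace X)) (op_cat (nat_htpy_cat n X)) (op_cat (nat_htpy_cat n Y))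
        (?\<eta> X) (mmap op_functor (nat_htpy_cat n X) (nat_htpy_cat n Y) (nat_htpy_cat_map n X Y \<phi>))"
      using nat_htpy_cat_reverse_natural[OF is_dispace_opp is_dispace_opp dmaps_opp, of X Y \<phi> n]
      by (simp add: opp_opp_dispace)
  qed
  with iso have "natural_isomorphism dTop Cat (funct_comp ?F reversal_functor) (funct_comp op_functor ?F) ?\<eta>"
    by (simp add: natural_isomorphism_def omaps dTop_simps)
  then show ?thesis
    unfolding strongly_time_reversal_def using is_functor_nat_htpy by blast
qed

end
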